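(* There is an algorithm that, given a graph $G$ with $n$ vertices and an integer $k$, decides whether $\mathrm{tcl}(G)\le k$ in time $O(2.4423^n)$.
   Context: All graphs are finite, simple and undirected. In exponential running-time bounds $O(c^n)$, polynomial factors in $n$ are suppressed. For a graph $G$ and $X\subseteq V(G)$, let $\mathrm{vcc}(X)$ be the minimum number of cliques of $G$ whose union is $X$. A tree decomposition of $G$ is a pair $(T,\{X_t\}_{t\in V(T)})$ with $T$ a tree and bags $X_t\subseteq V(G)$ such that every vertex lies in some bag, both endpoints of every edge lie in a common bag, and for every vertex $v$ the nodes $t$ with $v\in X_t$ induce a connected subtree of $T$. An augmented tree decomposition is a tree decomposition together with, for each node $t$, a collection $C_t$ of cliques of $G$ whose union is $X_t$; its width is $\max_t |C_t|$. The tree-clique width $\mathrm{tcl}(G)$ is the minimum width of an augmented tree decomposition of $G$, i.e. the minimum over tree decompositions of $\max_t \mathrm{vcc}(X_t)$. *)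

theory Defs
  imports Complex_Main "HOL-Library.Landau_Symbols"
begin

section \<open>Graphs and tree-clique width\<close>

type_synonym 'a graph = "'a set \<times> 'a set set"

abbreviation verts :: "'a graph \<Rightarrow> 'a set" where "verts \<equiv> fst"
abbreviation edges :: "'a graph \<Rightarrow> 'a set set" where "edges \<equiv> snd"

definition simple_graph :: "'a graph \<Rightarrow> bool" where
  "simple_graph G \<longleftrightarrow> finite (verts G) \<and> (\<forall>e\<in>edges G. e \<subseteq> verts G \<and> card e = 2)"

definition induced :: "'a graph \<Rightarrow> 'a set \<Rightarrow> 'a graph" where
  "induced G S = (verts G \<inter> S, {e \<in> edges G. e \<subseteq> S})"

definition graph_connected :: "'a graph \<Rightarrow> bool" where
  "graph_connected G \<longleftrightarrow> verts G \<noteq> {} \<and>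
     (\<forall>u\<in>verts G. \<forall>v\<in>verts G. (u, v) \<in> {(x, y). {x, y} \<in> edges G}\<^sup>*)"

definition graph_cycle :: "'a graph \<Rightarrow> 'a list \<Rightarrow> bool" where
  "graph_cycle G xs \<longleftrightarrow> 3 \<le> length xs \<and> distinct xs \<and>
     (\<forall>i<length xs. {xs ! i, xs ! (Suc i mod length xs)} \<in> edges G)"

definition graph_tree :: "'a graph \<Rightarrow> bool" where
  "graph_tree T \<longleftrightarrow> simple_graph T \<and> graph_connected T \<and> (\<nexists>xs. graph_cycle T xs)"

definition graph_clique :: "'a graph \<Rightarrow> 'a set \<Rightarrow> bool" where
  "graph_clique G K \<longleftrightarrow> K \<subseteq> verts G \<and> (\<forall>u\<in>K. \<forall>v\<in>K. u \<noteq> v \<longrightarrow> {u, v} \<in> edges G)"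

definition tree_decomposition :: "'a graph \<Rightarrow> 'b graph \<Rightarrow> ('b \<Rightarrow> 'a set) \<Rightarrow> bool" where
  "tree_decomposition G T X \<longleftrightarrow>
     graph_tree T \<and>
     (\<forall>t\<in>verts T. X t \<subseteq> verts G) \<and>
     (\<forall>v\<in>verts G. \<exists>t\<in>verts T. v \<in> X t) \<and>
     (\<forall>e\<in>edges G. \<exists>t\<in>verts T. e \<subseteq> X t) \<and>
     (\<forall>v\<in>verts G. graph_connected (induced T {t. v \<in> X t}))"

definition augmented_tree_decomposition ::
  "'a graph \<Rightarrow> 'b graph \<Rightarrow> ('b \<Rightarrow> 'a set) \<Rightarrow> ('b \<Rightarrow> 'a set set) \<Rightarrow> bool" where
  "augmented_tree_decomposition G T X C \<longleftrightarrow>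
     tree_decomposition G T X \<and>
     (\<forall>t\<in>verts T. (\<forall>K\<in>C t. graph_clique G K) \<and> \<Union>(C t) = X t)"

definition atd_width :: "'b graph \<Rightarrow> ('b \<Rightarrow> 'a set set) \<Rightarrow> nat" where
  "atd_width T C = Max ((\<lambda>t. card (C t)) ` verts T)"

text \<open>Trees are finite, so taking their nodes from \<^typ>\<open>nat\<close> loses no decomposition.\<close>

definition tcl :: "'a graph \<Rightarrow> nat" where
  "tcl G = (LEAST w. \<exists>(T :: nat graph) X C.
     augmented_tree_decomposition G T X C \<and> atd_width T C = w)"


section \<open>Word RAM programs\<close>

text \<open>
  The machine model is a word RAM with structured control flow. A machine with word length \<open>w\<close>
  has registers and a random access memory, whose cells (and addresses) are \<open>w\<close>-bit words in
  two's complement. Each arithmetic, bitwise, comparison or memory operation takes unit time.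
  A program is a finite piece of syntax that does not depend on the input or on \<open>w\<close>.
\<close>

datatype binop = Add | Sub | Mul | Div | Mod | And | Or | Xor | Lt | Eq

datatype exp = Const int | Reg nat | Load exp | Bin binop exp exp

datatype com =
    Skip
  | Assign nat exp
  | Store exp exp
  | Seq com com
  | If exp com com
  | While exp com

record state =
  regs :: "nat \<Rightarrow> int"
  mem :: "int \<Rightarrow> int"

fun binop_val :: "binop \<Rightarrow> int \<Rightarrow> int \<Rightarrow> int" where
  "binop_val Add x y = x + y"
| "binop_val Sub x y = x - y"
| "binop_val Mul x y = x * y"
| "binop_val Div x y = x div y"
| "binop_val Mod x y = x mod y"
| "binop_val And x y = Bit_Operations.and x y"
| "binop_val Or x y = Bit_Operations.or x y"
| "binop_val Xor x y = Bit_Operations.xor x y"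
| "binop_val Lt x y = of_bool (x < y)"
| "binop_val Eq x y = of_bool (x = y)"

primrec exp_val :: "exp \<Rightarrow> state \<Rightarrow> int" where
  "exp_val (Const c) s = c"
| "exp_val (Reg r) s = regs s r"
| "exp_val (Load e) s = mem s (exp_val e s)"
| "exp_val (Bin f e1 e2) s = binop_val f (exp_val e1 s) (exp_val e2 s)"

primrec exp_cost :: "exp \<Rightarrow> nat" where
  "exp_cost (Const c) = 1"
| "exp_cost (Reg r) = 1"
| "exp_cost (Load e) = exp_cost e + 1"
| "exp_cost (Bin f e1 e2) = exp_cost e1 + exp_cost e2 + 1"

text \<open>That is, \<open>- 2 ^ (w - 1) \<le> x < 2 ^ (w - 1)\<close>.\<close>

definition fits :: "nat \<Rightarrow> int \<Rightarrow> bool" where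
  "fits w x \<longleftrightarrow> - (2 ^ w) \<le> 2 * x \<and> 2 * x < 2 ^ w"

text \<open>
  All intermediate results of an evaluation have to fit into a word. An operation that overflows
  has no transition below, so a program that has a run never relies on overflow.
\<close>

primrec exp_fits :: "nat \<Rightarrow> exp \<Rightarrow> state \<Rightarrow> bool" where
  "exp_fits w (Const c) s \<longleftrightarrow> fits w c"
| "exp_fits w (Reg r) s \<longleftrightarrow> fits w (regs s r)"
| "exp_fits w (Load e) s \<longleftrightarrow> exp_fits w e s \<and> fits w (mem s (exp_val e s))"
| "exp_fits w (Bin f e1 e2) s \<longleftrightarrow> exp_fits w e1 s \<and> exp_fits w e2 s \<and>
     fits w (binop_val f (exp_val e1 s) (exp_val e2 s))"

text \<open>
  \<open>exec w c s t s'\<close>: with word length \<open>w\<close>, the program \<open>c\<close> started in \<open>s\<close> terminates in \<open>s'\<close>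
  after \<open>t\<close> time units.
\<close>

inductive exec :: "nat \<Rightarrow> com \<Rightarrow> state \<Rightarrow> nat \<Rightarrow> state \<Rightarrow> bool" for w :: nat where
  Skip: "exec w Skip s 1 s"
| Assign: "exp_fits w e s \<Longrightarrow>
    exec w (Assign r e) s (exp_cost e + 1) (s\<lparr>regs := (regs s)(r := exp_val e s)\<rparr>)"
| Store: "exp_fits w a s \<Longrightarrow> exp_fits w e s \<Longrightarrow>
    exec w (Store a e) s (exp_cost a + exp_cost e + 1)
      (s\<lparr>mem := (mem s)(exp_val a s := exp_val e s)\<rparr>)"
| Seq: "exec w c1 s t1 s1 \<Longrightarrow> exec w c2 s1 t2 s2 \<Longrightarrow> exec w (Seq c1 c2) s (t1 + t2) s2"
| IfTrue: "exp_fits w e s \<Longrightarrow> exp_val e s \<noteq> 0 \<Longrightarrow> exec w c1 s t s' \<Longrightarrow>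
    exec w (If e c1 c2) s (exp_cost e + 1 + t) s'"
| IfFalse: "exp_fits w e s \<Longrightarrow> exp_val e s = 0 \<Longrightarrow> exec w c2 s t s' \<Longrightarrow>
    exec w (If e c1 c2) s (exp_cost e + 1 + t) s'"
| WhileFalse: "exp_fits w e s \<Longrightarrow> exp_val e s = 0 \<Longrightarrow>
    exec w (While e c) s (exp_cost e + 1) s"
| WhileTrue: "exp_fits w e s \<Longrightarrow> exp_val e s \<noteq> 0 \<Longrightarrow> exec w c s t1 s1 \<Longrightarrow>
    exec w (While e c) s1 t2 s2 \<Longrightarrow>
    exec w (While e c) s (exp_cost e + 1 + t1 + t2) s2"


section \<open>Deciding graph problems with an integer parameter\<close>

text \<open>
  The input graph has vertex set \<open>{..<n}\<close>. Initially register 0 holds \<open>n\<close>, register 1 holds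
  \<open>k\<close>, and the memory cells \<open>0, \<dots>, n\<^sup>2 - 1\<close> hold the adjacency matrix row by row; all other
  registers and cells are 0.
\<close>

definition input_state :: "nat \<Rightarrow> nat set set \<Rightarrow> int \<Rightarrow> state" where
  "input_state n E k =
     \<lparr>regs = (\<lambda>_. 0)(0 := int n, 1 := k),
      mem = (\<lambda>a. of_bool (\<exists>i<n. \<exists>j<n. a = int (i * n + j) \<and> {i, j} \<in> E))\<rparr>"

text \<open>
  The program must work for every word length that can hold \<open>k\<close> and is at least some polynomial in
  \<open>n\<close>. The time bound is in terms of \<open>n\<close> alone. The answer (1 for yes, 0 for no) is left in
  register 0.
\<close>

definition decides_in_time ::
  "com \<Rightarrow> (nat graph \<Rightarrow> int \<Rightarrow> bool) \<Rightarrow> (nat \<Rightarrow> real) \<Rightarrow> bool" where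
  "decides_in_time P Q f \<longleftrightarrow> (\<exists>a d :: nat. \<forall>n E k w.
     simple_graph ({..<n}, E) \<longrightarrow> a * (n + 1) ^ d \<le> w \<longrightarrow> fits w k \<longrightarrow>
       (\<exists>t s'. exec w P (input_state n E k) t s' \<and> real t \<le> f n \<and>
               regs s' 0 = of_bool (Q ({..<n}, E) k)))"

end

theory Submission
  imports Defs "HOL-Library.Nat_Bijection"
begin

text \<open>
  A vertex order eliminates the vertices one by one; the bag of \<open>v\<close>, eliminated after the set \<open>S\<close>,
  consists of \<open>v\<close> and the vertices outside \<open>S\<close> that are reachable from \<open>v\<close> through \<open>S\<close>. As being
  covered by \<open>k\<close> cliques is inherited by subsets, \<open>tcl G \<le> k\<close> holds iff some order has only bags
  covered by \<open>k\<close> cliques: in a rooted tree decomposition, eliminate the vertices by decreasing depth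
  of their topmost bag; conversely, attach the bags one by one as leaves. The existence of an order
  is a reachability problem on vertex subsets.

  The subsets covered by \<open>k\<close> cliques are those \<open>Y\<close> for which the number of \<open>k\<close>-tuples of cliques with
  union \<open>Y\<close> is positive. The number of \<open>k\<close>-tuples of cliques inside \<open>Y\<close> is the \<open>k\<close>-th power of the number
  of cliques inside \<open>Y\<close>, and requiring the vertices to be covered one at a time is a Moebius
  transform, computed for all \<open>Y\<close> in place. This takes time \<open>O(2 ^ n)\<close> up to polynomial factors.
\<close>

section \<open>Rooted trees\<close>

text \<open>An order enters only through its prefixes: the bag of a vertex depends on the set
  eliminated before it and not on the order inside that set, so the \<open>n!\<close> orders
  collapse to paths through \<open>2 ^ n\<close> subsets. Tuples of cliques, with repetitions and
  empty members, replace sets of cliques because only for tuples is the count inside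
  \<open>Y\<close> a plain power. The price is the size of the numbers: a count may reach
  \<open>2 ^ (n * k)\<close>, and the machine has no transition for an overflowing operation. This
  is why the parameter is capped at \<open>n\<close>, which is sound since
  \<open>tcl G \<le> n\<close>, why words of quadratic length are requested, and why the machine
  part carries size bounds next to functional and time invariants. The resulting base 2 lies below
  2.4423.\<close>

lemma rtrancl_distinct_path:
  assumes "(a, b) \<in> r\<^sup>*"
  shows "\<exists>xs. xs \<noteq> [] \<and> hd xs = a \<and> last xs = b \<and> distinct xs \<and>
    (\<forall>i. Suc i < length xs \<longrightarrow> (xs ! i, xs ! Suc i) \<in> r)"
  using assms
proof (induction rule: rtrancl_induct)
  case base
  show ?case by (rule exI[of _ "[a]"]) simp
next
  case (step b c)
  then obtain xs where xs: "xs \<noteq> []" "hd xs = a" "last xs = b" "distinct xs"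
    "\<And>i. Suc i < length xs \<Longrightarrow> (xs ! i, xs ! Suc i) \<in> r" by blast
  show ?case
  proof (cases "c \<in> set xs")
    case True
    then obtain j where j: "j < length xs" "xs ! j = c" by (auto simp: in_set_conv_nth)
    \<comment> \<open>A repeated endpoint would spoil distinctness, so the path is cut at the
      earlier occurrence.\<close>
    have "last (take (Suc j) xs) = c" using j by (simp add: take_Suc_conv_app_nth)
    moreover have "hd (take (Suc j) xs) = a" using xs j by (simp add: hd_conv_nth)
    ultimately show ?thesis using xs j by (intro exI[of _ "take (Suc j) xs"]) auto
  next
    case False
    have "((xs @ [c]) ! i, (xs @ [c]) ! Suc i) \<in> r" if i: "Suc i < length (xs @ [c])" for i
    proof (cases "Suc i < length xs")
      case True
      then show ?thesis using xs(5)[of i] by (simp add: nth_append)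
    next
      case False
      with i have l: "Suc i = length xs" by simp
      then have "i = length xs - 1" by linarith
      then have "xs ! i = b" using last_conv_nth[OF xs(1)] xs(3) by argo
      moreover have "(xs @ [c]) ! i = xs ! i" using l by (intro nth_append_left) linarith
      moreover have "(xs @ [c]) ! Suc i = c" unfolding l by (rule nth_append_length)
      ultimately show ?thesis using step(2) by argo
    qed
    then show ?thesis using xs False by (intro exI[of _ "xs @ [c]"]) auto
  qed
qed

text \<open>A simple path from \<open>y\<close> to \<open>y'\<close> avoiding \<open>x\<close>
  closes up through \<open>x\<close> to a cycle; \<open>y \<noteq> y'\<close> makes it long enough
  to count as one.\<close>

lemma tree_neighbours_separated:
  assumes T: "graph_tree T" and y: "{x, y} \<in> edges T" "{x, y'} \<in> edges T" "y \<noteq> y'"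
  shows "(y, y') \<notin> {(a, b). {a, b} \<in> edges T \<and> a \<noteq> x \<and> b \<noteq> x}\<^sup>*"
proof
  assume "(y, y') \<in> {(a, b). {a, b} \<in> edges T \<and> a \<noteq> x \<and> b \<noteq> x}\<^sup>*"
  from rtrancl_distinct_path[OF this]
  obtain xs where xs: "xs \<noteq> []" "hd xs = y" "last xs = y'" "distinct xs"
    and "\<forall>i. Suc i < length xs \<longrightarrow>
      (xs ! i, xs ! Suc i) \<in> {(a, b). {a, b} \<in> edges T \<and> a \<noteq> x \<and> b \<noteq> x}"
    by (elim exE conjE)
  then have e: "{xs ! i, xs ! Suc i} \<in> edges T \<and> xs ! i \<noteq> x \<and> xs ! Suc i \<noteq> x"
    if "Suc i < length xs" for i using that by blast
  have "length xs \<noteq> 1" using xs y(3) by (auto simp: length_Suc_conv)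
  then have l: "length xs \<ge> 2" using xs(1) by (cases xs) (auto simp: Suc_le_eq)
  have "xs ! i \<noteq> x" if "i < length xs" for i
    using e[of i] e[of "i - 1"] that l by (cases "Suc i < length xs") (auto simp: Suc_lessI)
  then have x: "x \<notin> set xs" by (auto simp: in_set_conv_nth)
  have "{(xs @ [x]) ! i, (xs @ [x]) ! (Suc i mod length (xs @ [x]))} \<in> edges T"
    if i: "i < length (xs @ [x])" for i
  proof -
    from i have "Suc i < length xs \<or> Suc i = length xs \<or> i = length xs" by auto
    then consider "Suc i < length xs" | "Suc i = length xs" | "i = length xs" by blast
    then show ?thesis
    proof cases
      case 1
      then show ?thesis using e[of i] by (simp add: nth_append)
    next
      case 2
      then have "i = length xs - 1" by simp
      then have "xs ! i = y'" using xs(1,3) by (simp add: last_conv_nth)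
      then show ?thesis using 2 y by (simp add: nth_append insert_commute)
    next
      case 3
      then show ?thesis using xs y l by (simp add: nth_append hd_conv_nth)
    qed
  qed
  then have "graph_cycle T (xs @ [x])"
    using l x xs(4) by (auto simp: graph_cycle_def)
  then show False using T by (auto simp: graph_tree_def)
qed

text \<open>The root is arbitrary, \<open>d\<close> is the distance from it and \<open>par\<close>
  the neighbour that is not farther away. There is at most one: two such neighbours of
  \<open>t\<close> would both be joined to the root by shortest paths avoiding \<open>t\<close>,
  against \<open>tree_neighbours_separated\<close>. Only the orientation of the edges is
  exported.\<close>

lemma tree_rooted:
  assumes T: "graph_tree T"
  obtains par :: "'b \<Rightarrow> 'b" and d :: "'b \<Rightarrow> nat"
    where "\<And>s t. {s, t} \<in> edges T \<Longrightarrow> s = par t \<and> d s < d t \<or> t = par s \<and> d t < d s"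
proof -
  define A where "A = {(x, y). {x, y} \<in> edges T}"
  have sg: "simple_graph T" and con: "graph_connected T" using T by (auto simp: graph_tree_def)
  from con obtain r where r: "r \<in> verts T" by (auto simp: graph_connected_def)
  have reach: "(r, t) \<in> A\<^sup>*" if "t \<in> verts T" for t
    using con r that by (auto simp: graph_connected_def A_def)
  have inV: "s \<in> verts T" "t \<in> verts T" "s \<noteq> t" if "{s, t} \<in> edges T" for s t
    using sg that by (fastforce simp: simple_graph_def)+
  define d where "d t = (LEAST m. (r, t) \<in> A ^^ m)" for t
  have dI: "(r, t) \<in> A ^^ d t" if "t \<in> verts T" for t
    unfolding d_def using reach[OF that] by (metis LeastI rtrancl_imp_relpow)
  have dle: "d t \<le> m" if "(r, t) \<in> A ^^ m" for t m
    unfolding d_def using that by (rule Least_le)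
  have dpred: "\<exists>s. {s, t} \<in> edges T \<and> d s = m" if "t \<in> verts T" "d t = Suc m" for t m
  proof -
    from dI[OF that(1)] that(2) obtain s where s: "(r, s) \<in> A ^^ m" "(s, t) \<in> A" by auto
    then have "d s \<le> m" by (simp add: dle)
    moreover have "{s, t} \<in> edges T" using s by (simp add: A_def)
    moreover from this have "(r, t) \<in> A ^^ Suc (d s)" using dI[OF inV(1)] s(2) by auto
    then have "Suc m \<le> Suc (d s)" using dle that(2) by metis
    ultimately show ?thesis by (auto intro: le_antisym)
  qed
  \<comment> \<open>The earlier nodes of a shortest path to \<open>s\<close> are strictly closer to
    the root than \<open>s\<close>, which is no farther than \<open>t\<close>, so \<open>t\<close>
    is not among them.\<close>
  have avoid: "(r, s) \<in> {(a, b). {a, b} \<in> edges T \<and> a \<noteq> t \<and> b \<noteq> t}\<^sup>*"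
    if "d s = m" "s \<in> verts T" "m \<le> d t" "s \<noteq> t" for s t m
    using that
  proof (induction m arbitrary: s)
    case 0
    then show ?case using dI[of s] by simp
  next
    case (Suc m)
    then obtain s' where s': "{s', s} \<in> edges T" "d s' = m" using dpred by blast
    then have "s' \<noteq> t" using Suc.prems by auto
    moreover from this have "(r, s') \<in> {(a, b). {a, b} \<in> edges T \<and> a \<noteq> t \<and> b \<noteq> t}\<^sup>*"
      using Suc.IH[OF s'(2)] Suc.prems s' inV by auto
    ultimately show ?case using s' Suc.prems by (auto intro: rtrancl_into_rtrancl)
  qed
  have uniq: "s = s'" if "{t, s} \<in> edges T" "{t, s'} \<in> edges T" "d s \<le> d t" "d s' \<le> d t" for s s' t
  proof (rule ccontr)
    assume "s \<noteq> s'"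
    let ?R = "{(a, b). {a, b} \<in> edges T \<and> a \<noteq> t \<and> b \<noteq> t}"
    have "(r, s) \<in> ?R\<^sup>*" "(r, s') \<in> ?R\<^sup>*"
      using avoid[OF refl _ that(3)] avoid[OF refl _ that(4)] inV[OF that(1)] inV[OF that(2)] by auto
    moreover have "sym (?R\<^sup>*)" by (rule sym_rtrancl) (auto simp: sym_def insert_commute)
    ultimately have "(s, s') \<in> ?R\<^sup>*" by (meson rtrancl_trans symE)
    then show False using tree_neighbours_separated[OF T that(1,2) \<open>s \<noteq> s'\<close>] by simp
  qed
  define par where "par t = (THE s. {t, s} \<in> edges T \<and> d s \<le> d t)" for t
  have par: "s = par t \<and> d s < d t" if "{s, t} \<in> edges T" "d s \<le> d t" for s t
  proof
    have st: "{t, s} \<in> edges T" and tV: "t \<in> verts T"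
      using that(1) inV(2)[OF that(1)] by (simp_all add: insert_commute)
    show "s = par t" unfolding par_def
      by (rule the_equality[symmetric]) (use uniq[OF _ st _ that(2)] st that(2) in blast)+
    have "d t \<noteq> 0"
    proof
      assume "d t = 0"
      then have "(r, t) \<in> A ^^ 0" "(r, s) \<in> A ^^ 0"
        using dI[of t] dI[of s] inV[OF that(1)] that(2) by auto
      then show False using inV[OF that(1)] by simp
    qed
    then obtain m where m: "d t = Suc m" by (cases "d t") auto
    then obtain s' where s': "{s', t} \<in> edges T" "d s' = m" using dpred[OF tV] by blast
    \<comment> \<open>Uniqueness also excludes edges between nodes of equal distance: the
      predecessor on a shortest path to \<open>t\<close> is already the only neighbour that is not
      farther.\<close>
    have "s = s'" using uniq[OF st _ that(2), of s'] s' m by (simp add: insert_commute)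
    then show "d s < d t" using s' m by simp
  qed
  show ?thesis
  proof (rule that)
    fix s t assume "{s, t} \<in> edges T"
    then show "s = par t \<and> d s < d t \<or> t = par s \<and> d t < d s"
      using par[of s t] par[of t s] by (cases "d s \<le> d t") (auto simp: insert_commute)
  qed
qed


section \<open>Elimination orders\<close>

text \<open>\<open>via E S u w\<close>: there is a walk from \<open>u\<close> to \<open>w\<close> of positive length with all inner vertices in \<open>S\<close>.\<close>

inductive via :: "'a set set \<Rightarrow> 'a set \<Rightarrow> 'a \<Rightarrow> 'a \<Rightarrow> bool" for E S where
  edge: "{u, w} \<in> E \<Longrightarrow> via E S u w"
| through: "via E S u s \<Longrightarrow> s \<in> S \<Longrightarrow> via E S s w \<Longrightarrow> via E S u w"

lemma via_sym: "via E S u w \<Longrightarrow> via E S w u"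
proof (induction rule: via.induct)
  case (edge u w)
  then show ?case by (simp add: via.edge insert_commute)
next
  case (through u s w)
  show ?case by (rule via.through[OF through.IH(2) through.hyps(2) through.IH(1)])
qed

lemma via_mono: "via E S u w \<Longrightarrow> S \<subseteq> S' \<Longrightarrow> via E S' u w"
proof (induction rule: via.induct)
  case (edge u w)
  then show ?case by (simp add: via.edge)
next
  case (through u s w)
  show ?case
    by (rule via.through[OF through.IH(1)[OF through.prems] _ through.IH(2)[OF through.prems]])
      (use through in blast)
qed

lemma via_empty: "via E {} u w \<longleftrightarrow> {u, w} \<in> E"
  by (subst via.simps) simp

text \<open>A walk that visits \<open>s\<close> repeatedly can be cut down to its parts before the
  first and after the last visit. This Warshall recurrence serves twice: as the fill-in rule when
  \<open>s\<close> is eliminated, and as the update of the reachability matrix in the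
  program.\<close>

lemma via_insert: "via E (insert s S) u w \<longleftrightarrow> via E S u w \<or> via E S u s \<and> via E S s w"
proof
  assume "via E (insert s S) u w"
  then show "via E S u w \<or> via E S u s \<and> via E S s w"
  proof (induction rule: via.induct)
    case (edge u w)
    then show ?case by (simp add: via.edge)
  next
    case (through u m w)
    then show ?case by (cases "m = s") (blast, smt (verit) insertE via.through)
  qed
next
  have "via E (insert s S) x y" if "via E S x y" for x y using that by (auto intro: via_mono)
  then show "via E S u w \<or> via E S u s \<and> via E S s w \<Longrightarrow> via E (insert s S) u w"
    using via.through[of E "insert s S" u s w] by blast
qed

section \<open>Elimination orders obtained from tree decompositions\<close>

definition elim_bag :: "'a graph \<Rightarrow> 'a set \<Rightarrow> 'a \<Rightarrow> 'a set" where
  "elim_bag G S v = insert v {w \<in> verts G - S. via (edges G) S v w}"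

text \<open>Orders are recorded as chains of their prefixes. The bag tested is the closed
  neighbourhood of \<open>v\<close> in the graph filled in by eliminating \<open>S\<close>.\<close>

definition elim_step :: "'a graph \<Rightarrow> ('a set \<Rightarrow> bool) \<Rightarrow> ('a set \<times> 'a set) set" where
  "elim_step G good = {(S, insert v S) |S v. v \<in> verts G - S \<and> good (elim_bag G S v)}"

text \<open>The bag of \<open>v\<close> at its elimination is contained in the original bag at
  \<open>top v\<close>, and \<open>down\<close> passes goodness on to it. The reason: walks from
  \<open>v\<close> through vertices with deeper tops stay below \<open>top v\<close>, so an end
  vertex whose top is not deeper has \<open>top v\<close> among its nodes.\<close>

lemma tree_decomposition_imp_elim:
  assumes G: "simple_graph G" and td: "tree_decomposition G T X"
    and good: "\<And>t. t \<in> verts T \<Longrightarrow> good (X t)" and down: "\<And>A B. good B \<Longrightarrow> A \<subseteq> B \<Longrightarrow> good A"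
  shows "({}, verts G) \<in> (elim_step G good)\<^sup>*"
proof -
  have T: "graph_tree T" using td by (simp add: tree_decomposition_def)
  obtain par d where pd: "\<And>s t. {s, t} \<in> edges T \<Longrightarrow> s = par t \<and> d s < d t \<or> t = par s \<and> d t < (d s :: nat)"
    using tree_rooted[OF T] by blast
  \<comment> \<open>\<open>par\<close> is constrained on edges only; the guard makes every pair of
    \<open>P\<close> lower the depth, whatever \<open>par\<close> yields elsewhere.\<close>
  define P where "P = {(t, par t) |t. d (par t) < d t}"
  define Y where "Y v = {t \<in> verts T. v \<in> X t}" for v
  define top where "top v = arg_min_on d (Y v)" for v
  have fin: "finite (verts T)" using T by (simp add: graph_tree_def simple_graph_def)
  have Yne: "Y v \<noteq> {}" if "v \<in> verts G" for v
    using td that by (auto simp: tree_decomposition_def Y_def)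
  have topY: "top v \<in> Y v" and topmin: "\<And>t. t \<in> Y v \<Longrightarrow> d (top v) \<le> d t" if "v \<in> verts G" for v
  proof -
    have "finite (Y v)" using fin by (simp add: Y_def)
    then show "top v \<in> Y v" "\<And>t. t \<in> Y v \<Longrightarrow> d (top v) \<le> d t"
      unfolding top_def using arg_min_if_finite(1) arg_min_least Yne[OF that] by metis+
  qed
  have Pd: "d y \<le> d x \<and> (x \<noteq> y \<longrightarrow> d y < d x)" if "(x, y) \<in> P\<^sup>*" for x y
    using that by (induction rule: rtrancl_induct) (auto simp: P_def)
  have sv: "single_valued P" by (auto simp: P_def single_valued_def)
  have cmp: "(x, y) \<in> P\<^sup>*" if "(t, x) \<in> P\<^sup>*" "(t, y) \<in> P\<^sup>*" "d y \<le> d x" for t x y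
    using single_valued_confluent[OF sv that(1,2)] that(3) Pd[of y x]
    by (cases "x = y") auto
  \<comment> \<open>If the parent step failed at a node other than \<open>top v\<close>, the walk
    inside \<open>Y v\<close> from that node to \<open>top v\<close> could never leave the subtree
    below it, contradicting the minimal depth of \<open>top v\<close>.\<close>
  have up: "par t \<in> Y v \<and> d (par t) < d t" if v: "v \<in> verts G" and t: "t \<in> Y v" "t \<noteq> top v" for v t
  proof (rule ccontr)
    assume no: "\<not> (par t \<in> Y v \<and> d (par t) < d t)"
    have "(t, top v) \<in> {(x, y). {x, y} \<in> edges (induced T {t. v \<in> X t})}\<^sup>*"
      using td v t(1) topY[OF v] by (auto simp: tree_decomposition_def graph_connected_def induced_def Y_def)
    then have "top v \<in> Y v \<and> (top v, t) \<in> P\<^sup>*"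
    proof (induction rule: rtrancl_induct)
      case base
      then show ?case using t by simp
    next
      case (step s s')
      have e: "{s, s'} \<in> edges T" "s' \<in> Y v"
        using step(2) T by (auto simp: induced_def Y_def graph_tree_def simple_graph_def)
      from pd[OF e(1)] show ?case
      proof
        assume "s = par s' \<and> d s < d s'"
        then show ?thesis using step e by (auto simp: P_def intro: converse_rtrancl_into_rtrancl)
      next
        assume a: "s' = par s \<and> d s' < d s"
        then have "s \<noteq> t" using no e by auto
        then obtain z where "(s, z) \<in> P" "(z, t) \<in> P\<^sup>*" using step by (meson converse_rtranclE)
        then show ?thesis using a e by (auto simp: P_def)
      qed
    qed
    then show False using Pd[of "top v" t] topmin[OF v t(1)] t(2) by auto
  qed
  have toTop: "(t, top v) \<in> P\<^sup>*" if "v \<in> verts G" "t \<in> Y v" for v t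
    using that(2)
  proof (induction "d t" arbitrary: t rule: less_induct)
    case less
    show ?case
    proof (cases "t = top v")
      case False
      with up[OF that(1) less.prems] have "par t \<in> Y v" "d (par t) < d t" by auto
      moreover from this have "(t, par t) \<in> P" by (auto simp: P_def)
      ultimately show ?thesis using less.hyps by (meson converse_rtrancl_into_rtrancl)
    qed simp
  qed
  have between: "x \<in> Y v" if v: "v \<in> verts G" and "t \<in> Y v" "(t, x) \<in> P\<^sup>*" "d (top v) \<le> d x" for v t x
    using that(3,4,2)
  proof (induction rule: rtrancl_induct)
    case (step z z')
    then have z: "z' = par z" "d z' < d z" by (auto simp: P_def)
    then have "z \<in> Y v" "z \<noteq> top v" using step by auto
    then show ?case using up[OF v] z by auto
  qed
  \<comment> \<open>The first conjunct is the invariant for the inner vertices of the walk, whose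
    tops have depth at least \<open>d x\<close>: all their nodes stay below \<open>x\<close>. The
    second is what is used at the end: if \<open>w\<close> has a node below \<open>x\<close> and a
    top not deeper than \<open>x\<close>, its subtree has to pass through \<open>x\<close>.\<close>
  have key: "(d x \<le> d (top w) \<longrightarrow> (\<forall>t\<in>Y w. (t, x) \<in> P\<^sup>*)) \<and> (d (top w) \<le> d x \<longrightarrow> x \<in> Y w)"
    if "via (edges G) S u w" "S \<subseteq> verts G" "\<And>s. s \<in> S \<Longrightarrow> d x \<le> d (top s)"
      "\<forall>t\<in>Y u. (t, x) \<in> P\<^sup>*" "w \<in> verts G" for S u w x
    using that
  proof (induction rule: via.induct)
    case (edge u w)
    then obtain t where t: "t \<in> Y u" "t \<in> Y w"
      using td by (fastforce simp: tree_decomposition_def Y_def)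
    then have tx: "(t, x) \<in> P\<^sup>*" and tw: "(t, top w) \<in> P\<^sup>*" using edge toTop by auto
    then show ?case
      using cmp[OF tw tx] toTop[OF edge(5)] between[OF edge(5) t(2) tx]
      by (meson rtrancl_trans)
  next
    case (through u s w)
    then show ?case by blast
  qed
  have elim: "({}, S) \<in> (elim_step G good)\<^sup>*"
    if "S \<subseteq> verts G" "\<forall>s\<in>S. \<forall>w\<in>verts G - S. d (top w) \<le> d (top s)" for S
    using that
  proof (induction "card S" arbitrary: S)
    case 0
    then show ?case using G by (auto simp: simple_graph_def finite_subset)
  next
    case (Suc m)
    have finS: "finite S" using Suc.hyps(2) card_gt_0_iff by fastforce
    have "S \<noteq> {}" using Suc.hyps(2) by auto
    \<comment> \<open>The vertex of \<open>S\<close> eliminated last is one with a shallowest top,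
      so that the hypothesis on \<open>S\<close> survives its removal.\<close>
    define v where "v = arg_min_on (d \<circ> top) S"
    have v: "v \<in> S" "\<And>s. s \<in> S \<Longrightarrow> d (top v) \<le> d (top s)"
      unfolding v_def using arg_min_if_finite(1)[OF finS \<open>S \<noteq> {}\<close>] arg_min_least[OF finS \<open>S \<noteq> {}\<close>, of _ "d \<circ> top"] by auto
    have vG: "v \<in> verts G" using v Suc.prems by auto
    have "\<forall>s\<in>S - {v}. \<forall>w\<in>verts G - (S - {v}). d (top w) \<le> d (top s)"
      using Suc.prems(2) v(2) by auto
    moreover have "m = card (S - {v})" using Suc.hyps(2) v(1) finS by simp
    ultimately have "({}, S - {v}) \<in> (elim_step G good)\<^sup>*"
      using Suc.hyps(1)[of "S - {v}"] Suc.prems(1) by blast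
    moreover have "elim_bag G (S - {v}) v \<subseteq> X (top v)"
    proof
      fix w assume "w \<in> elim_bag G (S - {v}) v"
      then consider "w = v" | "w \<in> verts G - S" "via (edges G) (S - {v}) v w"
        by (auto simp: elim_bag_def)
      then show "w \<in> X (top v)"
      proof cases
        case 1
        then show ?thesis using topY[OF vG] by (simp add: Y_def)
      next
        case 2
        have "d (top w) \<le> d (top v)" using Suc.prems 2 v by auto
        moreover have "d (top w) \<le> d (top v) \<longrightarrow> top v \<in> Y w"
          using key[OF 2(2), of "top v"] toTop[OF vG] Suc.prems v 2 by blast
        ultimately show ?thesis by (simp add: Y_def)
      qed
    qed
    then have "good (elim_bag G (S - {v}) v)"
      using down good topY[OF vG] by (auto simp: Y_def)
    then have "(S - {v}, S) \<in> elim_step G good"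
      unfolding elim_step_def using v vG by (auto intro!: exI[of _ "S - {v}"] exI[of _ v])
    ultimately show ?case by (rule rtrancl_into_rtrancl)
  qed
  then show ?thesis by auto
qed

section \<open>Tree decompositions built from elimination orders\<close>

lemma graph_tree_add_leaf:
  assumes T: "graph_tree T" and t: "t \<in> verts T" and t': "t' \<notin> verts T"
  shows "graph_tree (insert t' (verts T), insert {t, t'} (edges T))" (is "graph_tree ?T")
proof -
  have sg: "simple_graph T" using T by (simp add: graph_tree_def)
  have ne: "t \<noteq> t'" using t t' by auto
  have e: "e \<subseteq> verts T" if "e \<in> edges T" for e using sg that by (auto simp: simple_graph_def)
  have "simple_graph ?T" using sg t ne by (auto simp: simple_graph_def)
  moreover have "graph_connected ?T"
  proof -
    let ?R = "{(x, y). {x, y} \<in> edges ?T}"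
    have "{(x, y). {x, y} \<in> edges T}\<^sup>* \<subseteq> ?R\<^sup>*" by (rule rtrancl_mono) auto
    then have "(u, v) \<in> ?R\<^sup>*" if "u \<in> verts T" "v \<in> verts T" for u v
      using T that by (auto simp: graph_tree_def graph_connected_def)
    moreover have "(t, t') \<in> ?R" "(t', t) \<in> ?R" by (auto simp: insert_commute)
    ultimately have "(u, t) \<in> ?R\<^sup>* \<and> (t, u) \<in> ?R\<^sup>*" if "u \<in> verts ?T" for u
      using that t by (auto)
    then show ?thesis unfolding graph_connected_def by (auto intro: rtrancl_trans)
  qed
  moreover have False if c: "graph_cycle ?T xs" for xs
  proof (cases "t' \<in> set xs")
    case False
    then have "graph_cycle T xs"
      using c unfolding graph_cycle_def
      by (auto simp: doubleton_eq_iff) (metis gr_implies_not0 length_pos_if_in_set mod_less_divisor nth_mem nat_neq_iff not_less_zero zero_less_iff_neq_zero)+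
    then show False using T by (auto simp: graph_tree_def)
  next
    case True
    then obtain i where i: "i < length xs" "xs ! i = t'" by (auto simp: in_set_conv_nth)
    let ?l = "length xs"
    have l: "3 \<le> ?l" "distinct xs" and
      ed: "\<And>i. i < ?l \<Longrightarrow> {xs ! i, xs ! (Suc i mod ?l)} \<in> edges ?T"
      using c by (auto simp: graph_cycle_def)
    have nb: "y = t" if "{t', y} \<in> edges ?T" for y
      using that e t' by (auto simp: doubleton_eq_iff)
    \<comment> \<open>\<open>p\<close> is the cyclic predecessor of \<open>i\<close>. Both
      neighbours of \<open>t'\<close> on the cycle are \<open>t\<close>, so predecessor and
      successor positions agree, which a length of at least 3 forbids.\<close>
    define p where "p = (if i = 0 then ?l - 1 else i - 1)"
    have p: "p < ?l" "Suc p mod ?l = i" using i l by (auto simp: p_def)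
    have "xs ! (Suc i mod ?l) = t" using ed[OF i(1)] i nb by auto
    moreover have "xs ! p = t" using ed[OF p(1)] p i nb by (auto simp: insert_commute)
    moreover have "Suc i mod ?l < ?l" using i(1) by (intro mod_less_divisor) linarith
    ultimately have "Suc i mod ?l = p" using l(2) p(1) by (metis nth_eq_iff_index_eq)
    then show False
    proof (cases "Suc i < ?l")
      case False
      then have "Suc i = ?l" using i(1) by simp
      then have "p = 0" using \<open>Suc i mod ?l = p\<close> by simp
      then show False using \<open>Suc i = ?l\<close> l(1) unfolding p_def by (cases "i = 0") auto
    next
      case True
      then have "Suc i = p" using \<open>Suc i mod ?l = p\<close> by simp
      then show False using True l(1) unfolding p_def by (cases "i = 0") auto
    qed
  qed
  ultimately show ?thesis by (auto simp: graph_tree_def)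
qed

text \<open>Backward induction along the order: the vertices outside \<open>S\<close> carry a
  decomposition of the torso, in which two vertices are adjacent when joined through
  \<open>S\<close>. The invariant speaks of torso cliques instead of edges: the bag of the next
  vertex, minus that vertex, is a clique after the elimination and hence lies inside some bag, where
  the new leaf is attached. At \<open>S = {}\<close>, cliques of size one and two yield the covering
  conditions.\<close>

lemma elim_imp_tree_decomposition:
  assumes G: "simple_graph G" and elim: "({}, verts G) \<in> (elim_step G good)\<^sup>*" and empty: "good {}"
  shows "\<exists>(T :: nat graph) X. tree_decomposition G T X \<and> (\<forall>t\<in>verts T. good (X t))"
proof -
  let ?tor = "\<lambda>S K. \<forall>u\<in>K. \<forall>w\<in>K. u \<noteq> w \<longrightarrow> via (edges G) S u w"
  from elim have "\<exists>(T :: nat graph) X. graph_tree T \<and> (\<forall>t\<in>verts T. X t \<subseteq> verts G - {} \<and> good (X t)) \<and>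
    (\<forall>v\<in>verts G - {}. graph_connected (induced T {t. v \<in> X t})) \<and>
    (\<forall>K. K \<subseteq> verts G - {} \<and> ?tor {} K \<longrightarrow> (\<exists>t\<in>verts T. K \<subseteq> X t))"
  proof (induction rule: converse_rtrancl_induct)
    case base
    \<comment> \<open>The start, with all vertices eliminated, is a single node with the empty bag;
      here \<open>good {}\<close> enters.\<close>
    have "\<not> graph_cycle ({0}, {}) xs" for xs :: "nat list"
      by (auto simp: graph_cycle_def intro!: exI[of _ 0])
    then show ?case
      by (intro exI[of _ "({0}, {})"] exI[of _ "\<lambda>_. {}"])
        (auto simp: graph_tree_def simple_graph_def graph_connected_def empty)
  next
    case (step S S')
    then obtain v where v: "v \<in> verts G - S" "S' = insert v S" "good (elim_bag G S v)"
      by (auto simp: elim_step_def)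
    let ?B = "elim_bag G S v"
    from step.IH obtain T :: "nat graph" and X where T: "graph_tree T"
      and X: "\<forall>t\<in>verts T. X t \<subseteq> verts G - S' \<and> good (X t)"
      and con: "\<forall>v\<in>verts G - S'. graph_connected (induced T {t. v \<in> X t})"
      and cl': "\<forall>K. K \<subseteq> verts G - S' \<and> ?tor S' K \<longrightarrow> (\<exists>t\<in>verts T. K \<subseteq> X t)"
      by (elim exE conjE)
    have cl: "\<exists>t\<in>verts T. K \<subseteq> X t" if "K \<subseteq> verts G - S'" "?tor S' K" for K
      using cl' that by blast
    \<comment> \<open>Any two of the remaining neighbours of \<open>v\<close> become joined through
      \<open>v\<close> once it is eliminated.\<close>
    have "?tor S' (?B - {v})"
    proof (intro ballI impI)
      fix u w assume "u \<in> ?B - {v}" "w \<in> ?B - {v}"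
      then have "via (edges G) S u v" "via (edges G) S v w" by (auto simp: elim_bag_def intro: via_sym)
      then show "via (edges G) S' u w" unfolding v(2) by (simp add: via_insert)
    qed
    moreover have "?B - {v} \<subseteq> verts G - S'" by (auto simp: elim_bag_def v)
    ultimately obtain t where t: "t \<in> verts T" "?B - {v} \<subseteq> X t" using cl by blast
    have sg: "simple_graph T" using T by (simp add: graph_tree_def)
    obtain t' where t': "t' \<notin> verts T"
      using sg ex_new_if_finite[of "verts T"] by (auto simp: simple_graph_def)
    define T' where "T' = (insert t' (verts T), insert {t, t'} (edges T))"
    define X' where "X' = X(t' := ?B)"
    have eT: "t' \<notin> e" if "e \<in> edges T" for e using sg that t' by (auto simp: simple_graph_def)
    have X'T: "X' s = X s" if "s \<in> verts T" for s using that t' by (auto simp: X'_def)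
    have "graph_tree T'" unfolding T'_def by (rule graph_tree_add_leaf[OF T t(1) t'])
    moreover have "\<forall>s\<in>verts T'. X' s \<subseteq> verts G - S \<and> good (X' s)"
    proof
      fix s assume s: "s \<in> verts T'"
      show "X' s \<subseteq> verts G - S \<and> good (X' s)"
      proof (cases "s = t'")
        case True
        then show ?thesis using v by (auto simp: X'_def elim_bag_def)
      next
        case False
        then have "s \<in> verts T" using s by (simp add: T'_def)
        then show ?thesis using X v(2) X'T by fastforce
      qed
    qed
    moreover have "\<forall>u\<in>verts G - S. graph_connected (induced T' {s. u \<in> X' s})"
    proof
      fix u assume u: "u \<in> verts G - S"
      show "graph_connected (induced T' {s. u \<in> X' s})"
      proof (cases "u = v")
        case True
        have *: "s \<in> verts T \<Longrightarrow> u \<notin> X s" for s using X v True by blast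
        have "verts (induced T' {s. u \<in> X' s}) = {t'}"
          using * X'T by (auto simp: induced_def T'_def X'_def True elim_bag_def)
        then show ?thesis by (simp add: graph_connected_def)
      next
        case False
        let ?H = "induced T {s. u \<in> X s}" and ?H' = "induced T' {s. u \<in> X' s}"
        have c: "graph_connected ?H" using con u False v by auto
        let ?R = "{(x, y). {x, y} \<in> edges ?H}" and ?R' = "{(x, y). {x, y} \<in> edges ?H'}"
        have "e \<subseteq> {s. u \<in> X' s}" if "e \<in> edges T" "e \<subseteq> {s. u \<in> X s}" for e
          using that eT[OF that(1)] by (auto simp: X'_def)
        then have "?R \<subseteq> ?R'" by (auto simp: induced_def T'_def)
        then have mono: "?R\<^sup>* \<subseteq> ?R'\<^sup>*" by (rule rtrancl_mono)
        show ?thesis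
        proof (cases "u \<in> ?B")
          case True
          then have ut: "u \<in> X t" using t False by auto
          have vs: "verts ?H' = insert t' (verts ?H)"
            using True X'T by (auto simp: induced_def T'_def X'_def)
          have "(t, t') \<in> ?R'" "(t', t) \<in> ?R'"
            using ut True t t' by (auto simp: induced_def T'_def X'_def insert_commute)
          moreover have "t \<in> verts ?H" using t ut by (simp add: induced_def)
          ultimately have "(s, t) \<in> ?R'\<^sup>* \<and> (t, s) \<in> ?R'\<^sup>*" if "s \<in> verts ?H'" for s
            using that c mono unfolding vs by (auto simp: graph_connected_def)
          then show ?thesis unfolding graph_connected_def using vs by (auto intro: rtrancl_trans)
        next
          case F: False
          have "verts ?H' = verts ?H" using F X'T t' by (auto simp: induced_def T'_def X'_def)
          then show ?thesis using c mono by (auto simp: graph_connected_def)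
        qed
      qed
    qed
    moreover have "\<forall>K. K \<subseteq> verts G - S \<and> ?tor S K \<longrightarrow> (\<exists>s\<in>verts T'. K \<subseteq> X' s)"
    proof (intro allI impI, elim conjE)
      fix K assume K: "K \<subseteq> verts G - S" "?tor S K"
      show "\<exists>s\<in>verts T'. K \<subseteq> X' s"
      proof (cases "v \<in> K")
        case True
        then have "K \<subseteq> ?B" using K by (auto simp: elim_bag_def)
        then show ?thesis by (auto simp: T'_def X'_def)
      next
        case False
        then have "K \<subseteq> verts G - S'" "?tor S' K" using K v by (auto intro: via_mono)
        then obtain s where "s \<in> verts T" "K \<subseteq> X s" using cl by blast
        then show ?thesis using X'T by (auto simp: T'_def)
      qed
    qed
    ultimately show ?case by (intro exI conjI)
  qed
  then obtain T :: "nat graph" and X where T: "graph_tree T" "\<forall>t\<in>verts T. X t \<subseteq> verts G \<and> good (X t)"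
    "\<forall>v\<in>verts G. graph_connected (induced T {t. v \<in> X t})"
    and cl': "\<forall>K. K \<subseteq> verts G \<and> ?tor {} K \<longrightarrow> (\<exists>t\<in>verts T. K \<subseteq> X t)"
    unfolding Diff_empty by (elim exE conjE)
  have cl: "\<exists>t\<in>verts T. K \<subseteq> X t" if "K \<subseteq> verts G" "?tor {} K" for K using cl' that by blast
  have "\<exists>t\<in>verts T. v \<in> X t" if "v \<in> verts G" for v using cl[of "{v}"] that by auto
  moreover have "\<exists>t\<in>verts T. e \<subseteq> X t" if "e \<in> edges G" for e
  proof -
    have "e \<subseteq> verts G" "card e = 2" using G that by (auto simp: simple_graph_def)
    moreover from this obtain x y where "e = {x, y}" by (auto simp: card_2_iff)
    ultimately show ?thesis using that by (intro cl) (auto simp: via_empty insert_commute)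
  qed
  ultimately have "tree_decomposition G T X" using T by (simp add: tree_decomposition_def)
  then show ?thesis using T by blast
qed

section \<open>Clique covers and the characterisation of tree-clique width\<close>

definition clique_coverable :: "'a graph \<Rightarrow> nat \<Rightarrow> 'a set \<Rightarrow> bool" where
  "clique_coverable G k X \<longleftrightarrow> (\<exists>C. (\<forall>K\<in>C. graph_clique G K) \<and> \<Union>C = X \<and> finite C \<and> card C \<le> k)"

text \<open>The cliques are intersected with \<open>A\<close>. Distinct ones may merge, which is why
  the definition bounds the number of cliques instead of fixing it.\<close>

lemma clique_coverable_subset:
  assumes "clique_coverable G k B" "A \<subseteq> B"
  shows "clique_coverable G k A"
proof -
  obtain C where C: "\<forall>K\<in>C. graph_clique G K" "\<Union>C = B" "finite C" "card C \<le> k"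
    using assms by (auto simp: clique_coverable_def)
  have "card ((\<lambda>K. K \<inter> A) ` C) \<le> k" using card_image_le[OF C(3)] C(4) le_trans by blast
  then show ?thesis unfolding clique_coverable_def
    using C assms(2) by (intro exI[of _ "(\<lambda>K. K \<inter> A) ` C"]) (auto simp: graph_clique_def)
qed

lemma clique_coverable_card:
  assumes "simple_graph G" "X \<subseteq> verts G"
  shows "clique_coverable G (card (verts G)) X"
proof -
  have f: "finite (verts G)" "finite X" using assms by (auto simp: simple_graph_def finite_subset)
  have "card ((\<lambda>v. {v}) ` X) \<le> card (verts G)"
    using card_image_le[OF f(2)] card_mono[OF f(1) assms(2)] le_trans by blast
  then show ?thesis unfolding clique_coverable_def
    using assms f by (intro exI[of _ "(\<lambda>v. {v}) ` X"]) (auto simp: graph_clique_def)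
qed

lemma atd_imp_elim:
  assumes G: "simple_graph G" and atd: "augmented_tree_decomposition G T X C" and w: "atd_width T C \<le> k"
  shows "({}, verts G) \<in> (elim_step G (clique_coverable G k))\<^sup>*"
proof (rule tree_decomposition_imp_elim[OF G])
  show td: "tree_decomposition G T X" using atd by (simp add: augmented_tree_decomposition_def)
  then have fT: "finite (verts T)" by (auto simp: tree_decomposition_def graph_tree_def simple_graph_def)
  fix t assume t: "t \<in> verts T"
  have C: "\<forall>K\<in>C t. graph_clique G K" "\<Union>(C t) = X t"
    using atd t by (auto simp: augmented_tree_decomposition_def)
  then have "C t \<subseteq> Pow (verts G)" by (auto simp: graph_clique_def)
  then have "finite (C t)" using G by (meson finite_Pow_iff finite_subset simple_graph_def)
  moreover have "card (C t) \<le> atd_width T C" unfolding atd_width_def using t fT by simp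
  then have "card (C t) \<le> k" using w by simp
  ultimately show "clique_coverable G k (X t)" using C by (auto simp: clique_coverable_def)
qed (rule clique_coverable_subset)

lemma elim_imp_atd:
  assumes G: "simple_graph G" and elim: "({}, verts G) \<in> (elim_step G (clique_coverable G k))\<^sup>*"
  shows "\<exists>(T :: nat graph) X C. augmented_tree_decomposition G T X C \<and> atd_width T C \<le> k"
proof -
  have "clique_coverable G k {}" unfolding clique_coverable_def by (rule exI[of _ "{}"]) simp
  from elim_imp_tree_decomposition[OF G elim this] obtain T :: "nat graph" and X where
    td: "tree_decomposition G T X" and cov: "\<forall>t\<in>verts T. clique_coverable G k (X t)" by blast
  from cov obtain C where C: "\<forall>t\<in>verts T. (\<forall>K\<in>C t. graph_clique G K) \<and> \<Union>(C t) = X t \<and> finite (C t) \<and> card (C t) \<le> k"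
    unfolding clique_coverable_def by metis
  have "finite (verts T)" "verts T \<noteq> {}"
    using td by (auto simp: tree_decomposition_def graph_tree_def simple_graph_def graph_connected_def)
  then have "atd_width T C \<le> k" using C by (simp add: atd_width_def)
  then show ?thesis using td C unfolding augmented_tree_decomposition_def by blast
qed

text \<open>Any order works, with bags covered by singletons. This makes the set of widths nonempty,
  without which \<open>LEAST\<close> in \<open>tcl\<close> would carry no information, and it bounds
  \<open>tcl G\<close> by the number of vertices.\<close>

lemma elim_card:
  assumes G: "simple_graph G"
  shows "({}, verts G) \<in> (elim_step G (clique_coverable G (card (verts G))))\<^sup>*"
proof -
  have "({}, S) \<in> (elim_step G (clique_coverable G (card (verts G))))\<^sup>*" if "finite S" "S \<subseteq> verts G" for S
    using that
  proof (induction S rule: finite_induct)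
    case (insert v S)
    have "clique_coverable G (card (verts G)) (elim_bag G S v)"
      using insert.prems by (intro clique_coverable_card[OF G]) (auto simp: elim_bag_def)
    then have "(S, insert v S) \<in> elim_step G (clique_coverable G (card (verts G)))"
      using insert by (auto simp: elim_step_def)
    then show ?case using insert by (auto intro: rtrancl_into_rtrancl)
  qed simp
  then show ?thesis using G by (auto simp: simple_graph_def)
qed

lemma tcl_le_iff_elim:
  assumes G: "simple_graph G"
  shows "tcl G \<le> k \<longleftrightarrow> ({}, verts G) \<in> (elim_step G (clique_coverable G k))\<^sup>*"
proof -
  let ?W = "\<lambda>w. \<exists>(T :: nat graph) X C. augmented_tree_decomposition G T X C \<and> atd_width T C = w"
  have le: "tcl G \<le> k \<longleftrightarrow> (\<exists>w\<le>k. ?W w)" if "?W w0" for w0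
  proof
    assume "tcl G \<le> k"
    moreover have "?W (tcl G)" unfolding tcl_def using that by (rule LeastI)
    ultimately show "\<exists>w\<le>k. ?W w" by blast
  next
    assume "\<exists>w\<le>k. ?W w"
    then obtain w where "w \<le> k" "?W w" by blast
    moreover from this have "tcl G \<le> w" unfolding tcl_def by (intro Least_le)
    ultimately show "tcl G \<le> k" by simp
  qed
  obtain w0 where w0: "?W w0"
    using elim_imp_atd[OF G elim_card[OF G]] by blast
  show ?thesis unfolding le[OF w0] using atd_imp_elim[OF G] elim_imp_atd[OF G] by blast
qed

lemma tcl_le_card:
  assumes "simple_graph G"
  shows "tcl G \<le> card (verts G)"
  unfolding tcl_le_iff_elim[OF assms] by (rule elim_card[OF assms])


section \<open>Counting tuples of cliques\<close>

definition cliques_in :: "'a graph \<Rightarrow> 'a set \<Rightarrow> 'a set set" where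
  "cliques_in G Y = {K. K \<subseteq> Y \<and> graph_clique G K}"

lemma finite_cliques_in: "finite Y \<Longrightarrow> finite (cliques_in G Y)"
  by (rule finite_subset[of _ "Pow Y"]) (auto simp: cliques_in_def)

lemma card_cliques_in_le: "finite Y \<Longrightarrow> card (cliques_in G Y) \<le> 2 ^ card Y"
  using card_mono[of "Pow Y" "cliques_in G Y"] by (auto simp: card_Pow cliques_in_def)

lemma cliques_in_empty [simp]: "cliques_in G {} = {{}}"
  by (auto simp: cliques_in_def graph_clique_def)

text \<open>Cliques containing \<open>v\<close> correspond, by removing \<open>v\<close>, to cliques
  inside the neighbourhood of \<open>v\<close>. This is the recurrence behind array 3.\<close>

lemma card_cliques_in_insert:
  assumes "finite Y" "v \<in> verts G" "v \<notin> Y"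
  shows "card (cliques_in G (insert v Y)) =
    card (cliques_in G Y) + card (cliques_in G (Y \<inter> {u. {v, u} \<in> edges G}))"
proof -
  let ?N = "{u. {v, u} \<in> edges G}"
  have "cliques_in G (insert v Y) = cliques_in G Y \<union> insert v ` cliques_in G (Y \<inter> ?N)" (is "?L = ?R")
  proof
    show "?L \<subseteq> ?R"
    proof
      fix K assume K: "K \<in> ?L"
      show "K \<in> ?R"
      proof (cases "v \<in> K")
        case True
        then have "K = insert v (K - {v})" by blast
        moreover have "K - {v} \<in> cliques_in G (Y \<inter> ?N)"
          using K True by (auto simp: cliques_in_def graph_clique_def)
        ultimately show ?thesis by blast
      qed (use K in \<open>auto simp: cliques_in_def\<close>)
    qed
    show "?R \<subseteq> ?L" using assms(2) by (auto simp: cliques_in_def graph_clique_def insert_commute)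
  qed
  moreover have "inj_on (insert v) (cliques_in G (Y \<inter> ?N))"
    using assms(3) by (intro inj_onI) (auto simp: cliques_in_def)
  moreover have "cliques_in G Y \<inter> insert v ` cliques_in G (Y \<inter> ?N) = {}"
    using assms(3) by (auto simp: cliques_in_def)
  ultimately show ?thesis
    using assms(1) by (simp add: card_Un_disjoint finite_cliques_in card_image)
qed

text \<open>\<open>Z\<close> interpolates between two counts: \<open>Z = {}\<close> gives the power
  of the number of cliques inside \<open>Y\<close>, and \<open>Z = Y\<close> the tuples whose union
  is exactly \<open>Y\<close>.\<close>

definition clique_tuples :: "'a graph \<Rightarrow> nat \<Rightarrow> 'a set \<Rightarrow> 'a set \<Rightarrow> 'a set list set" where
  "clique_tuples G k Y Z = {Ks. length Ks = k \<and> set Ks \<subseteq> cliques_in G Y \<and> Z \<subseteq> \<Union>(set Ks)}"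

lemma finite_clique_tuples: "finite Y \<Longrightarrow> finite (clique_tuples G k Y Z)"
  by (rule finite_subset[OF _ finite_lists_length_eq[OF finite_cliques_in, of Y G k]])
    (auto simp: clique_tuples_def)

lemma card_clique_tuples_empty:
  assumes "finite Y"
  shows "card (clique_tuples G k Y {}) = card (cliques_in G Y) ^ k"
proof -
  have "clique_tuples G k Y {} = {Ks. set Ks \<subseteq> cliques_in G Y \<and> length Ks = k}"
    by (auto simp: clique_tuples_def)
  then show ?thesis using assms by (simp add: card_lists_length_eq finite_cliques_in)
qed

text \<open>Tuples are split by whether they cover \<open>v\<close>; those that do not live inside
  \<open>Y - {v}\<close>. Solved for the first summand, this is one step of the Moebius
  transform.\<close>

lemma card_clique_tuples_insert:
  assumes "finite Y" "v \<in> Y" "v \<notin> Z" "Z \<subseteq> Y"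
  shows "card (clique_tuples G k Y Z) =
    card (clique_tuples G k Y (insert v Z)) + card (clique_tuples G k (Y - {v}) Z)"
proof -
  have "clique_tuples G k Y Z = clique_tuples G k Y (insert v Z) \<union> clique_tuples G k (Y - {v}) Z"
    using assms(2) by (auto simp: clique_tuples_def cliques_in_def)
  moreover have "clique_tuples G k Y (insert v Z) \<inter> clique_tuples G k (Y - {v}) Z = {}"
    by (auto simp: clique_tuples_def cliques_in_def)
  ultimately show ?thesis
    using assms(1) by (simp add: card_Un_disjoint finite_clique_tuples)
qed

text \<open>With \<open>card Y \<le> n\<close> and \<open>k \<le> n\<close> the exponent is at most
  \<open>n * n\<close>, which is where the quadratic word length comes from.\<close>

lemma card_clique_tuples_le:
  assumes "finite Y"
  shows "card (clique_tuples G k Y Z) \<le> (2 ^ card Y) ^ k"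
proof -
  have "card (clique_tuples G k Y Z) \<le> card (clique_tuples G k Y {})"
    by (rule card_mono[OF finite_clique_tuples[OF assms]]) (auto simp: clique_tuples_def)
  also have "\<dots> \<le> (2 ^ card Y) ^ k"
    unfolding card_clique_tuples_empty[OF assms] by (rule power_mono) (auto simp: card_cliques_in_le assms)
  finally show ?thesis .
qed

text \<open>A cover by fewer than \<open>k\<close> cliques is padded with the empty clique;
  conversely, repeated members of a tuple merge, which only lowers their number.\<close>

lemma clique_coverable_iff_card:
  assumes "finite Y"
  shows "clique_coverable G k Y \<longleftrightarrow> 0 < card (clique_tuples G k Y Y)"
proof
  assume "clique_coverable G k Y"
  then obtain C where C: "\<forall>K\<in>C. graph_clique G K" "\<Union>C = Y" "finite C" "card C \<le> k"
    by (auto simp: clique_coverable_def)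
  from finite_distinct_list[OF C(3)] obtain Ks where Ks: "set Ks = C" "distinct Ks" by blast
  have "length Ks \<le> k" using Ks C(4) by (auto simp: distinct_card[symmetric])
  then have "Ks @ replicate (k - length Ks) {} \<in> clique_tuples G k Y Y"
    using Ks C by (auto simp: clique_tuples_def cliques_in_def graph_clique_def)
  then show "0 < card (clique_tuples G k Y Y)"
    using finite_clique_tuples[OF assms] card_gt_0_iff by blast
next
  assume "0 < card (clique_tuples G k Y Y)"
  then obtain Ks where Ks: "length Ks = k" "set Ks \<subseteq> cliques_in G Y" "Y \<subseteq> \<Union>(set Ks)"
    by (auto simp: card_gt_0_iff clique_tuples_def)
  then have "\<forall>K\<in>set Ks. graph_clique G K" "\<Union>(set Ks) = Y" "card (set Ks) \<le> k"
    using card_length by (auto simp: cliques_in_def)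
  then show "clique_coverable G k Y" unfolding clique_coverable_def by blast
qed


section \<open>Bit masks\<close>

definition bits :: "nat \<Rightarrow> nat set" where "bits x = {i. bit x i}"

lemma mem_bits [simp]: "i \<in> bits x \<longleftrightarrow> bit x i" by (simp add: bits_def)

lemma bits_0 [simp]: "bits 0 = {}" by (simp add: bits_def)

lemma bits_inject: "bits x = bits y \<longleftrightarrow> x = y"
  by (auto simp: bits_def set_eq_iff bit_eq_iff)

lemma bits_and: "bits (and x y) = bits x \<inter> bits y"
  and bits_or: "bits (or x y) = bits x \<union> bits y"
  by (auto simp: bits_def bit_simps)

text \<open>Set difference in terms of the operations of the machine, which has \<open>And\<close>
  and \<open>Xor\<close> but no complement.\<close>

lemma bits_diff: "bits (xor x (and x y)) = bits x - bits y"
  by (auto simp: bits_def bit_simps)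

lemma bits_exp: "bits (2 ^ i) = {i}"
  by (auto simp: bits_def bit_simps)

lemma bits_mask: "bits (2 ^ n - 1) = {..<n}"
  unfolding mask_eq_exp_minus_1[symmetric] by (auto simp: bit_simps)

lemma bits_subset_iff: "bits x \<subseteq> {..<n} \<longleftrightarrow> x < 2 ^ n"
proof
  assume "bits x \<subseteq> {..<n}"
  then have "take_bit n x = x" by (auto simp: bit_eq_iff bit_simps)
  then show "x < 2 ^ n" by (simp add: take_bit_nat_eq_self_iff)
next
  assume "x < 2 ^ n"
  then have eq: "take_bit n x = x" by (simp add: take_bit_nat_eq_self_iff)
  have "i < n" if "bit x i" for i
  proof -
    have "bit (take_bit n x) i" using that by (subst eq)
    then show "i < n" by (simp add: bit_take_bit_iff)
  qed
  then show "bits x \<subseteq> {..<n}" by auto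
qed

lemma add_exp_eq_or: "\<not> bit (x :: nat) i \<Longrightarrow> x + 2 ^ i = or x (2 ^ i)"
  by (intro disjunctive_add) (auto simp: bit_simps)

lemma bits_add: "\<not> bit x i \<Longrightarrow> bits (x + 2 ^ i) = insert i (bits x)"
  by (simp add: add_exp_eq_or bits_or bits_exp)

lemma bit_le: "bit (x :: nat) i \<Longrightarrow> 2 ^ i \<le> x"
  by (rule ccontr) (simp add: bit_iff_odd)

lemma bits_sub:
  assumes "bit x i"
  shows "bits (x - 2 ^ i) = bits x - {i}"
proof -
  define y where "y = xor x (2 ^ i)"
  have "\<not> bit y i" using assms by (simp add: y_def bit_simps)
  moreover have bits_y: "bits y = bits x - {i}" using assms by (auto simp: y_def bit_simps)
  ultimately have "bits (y + 2 ^ i) = insert i (bits x - {i})" using bits_add[of y i] by argo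
  also have "\<dots> = bits x" using assms by auto
  finally have "y + 2 ^ i = x" by (simp only: bits_inject)
  then have "x - 2 ^ i = y" by simp
  then show ?thesis by (simp only: bits_y)
qed

definition code :: "nat set \<Rightarrow> nat" where "code A = set_encode A"

lemma bits_code: "finite A \<Longrightarrow> bits (code A) = A"
  using set_encode_inverse[of A] by (simp add: bits_def code_def set_decode_def bit_iff_odd)

lemma finite_bits [simp]: "finite (bits x)"
proof (rule finite_subset)
  show "bits x \<subseteq> {..<x}"
  proof
    fix i assume "i \<in> bits x"
    then have "2 ^ i \<le> x" by (simp add: bit_le)
    then show "i \<in> {..<x}" using order.strict_trans2[OF less_exp] by simp
  qed
qed simp

lemma code_bits [simp]: "code (bits x) = x"
  using bits_inject[of "code (bits x)" x] bits_code[OF finite_bits] by simp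

lemma code_less: "A \<subseteq> {..<n} \<Longrightarrow> code A < 2 ^ n"
  using bits_subset_iff[of "code A" n] bits_code[OF finite_subset[OF _ finite_lessThan]] by simp

lemma code_or: "finite A \<Longrightarrow> finite B \<Longrightarrow> or (code A) (code B) = code (A \<union> B)"
  by (simp add: bits_code bits_or flip: bits_inject)

lemma code_diff: "finite A \<Longrightarrow> finite B \<Longrightarrow> xor (code A) (and (code A) (code B)) = code (A - B)"
  by (simp add: bits_code bits_diff flip: bits_inject)

lemma code_singleton: "2 ^ i = code {i}"
  by (simp add: bits_code bits_exp flip: bits_inject)

text \<open>The machine has no shift; bits are extracted by dividing by a tabulated power of
  2.\<close>

lemma bit_nat_eq: "int x div 2 ^ i mod 2 = of_bool (bit x i)"
proof -
  have "int x div 2 ^ i mod 2 = int (x div 2 ^ i mod 2)" by (simp add: zdiv_int zmod_int)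
  then show ?thesis by (simp add: bit_iff_odd mod_2_eq_odd)
qed


section \<open>Verification conditions for word RAM programs\<close>

text \<open>Equivalent to \<open>fits (m + 1)\<close>. Measured by exponents, bounds simply add up
  under multiplication.\<close>

definition bnd :: "nat \<Rightarrow> int \<Rightarrow> bool" where
  "bnd m x \<longleftrightarrow> - (2 ^ m) \<le> x \<and> x < 2 ^ m"

lemma bnd_mono: "bnd m x \<Longrightarrow> m \<le> m' \<Longrightarrow> bnd m' x"
  using power_increasing[of m m' "2 :: int"] unfolding bnd_def by linarith

lemma bnd_natI: "x < 2 ^ m \<Longrightarrow> bnd m (int x)"
proof -
  assume "x < 2 ^ m"
  then have "int x < int (2 ^ m)" by (simp only: of_nat_less_iff)
  then show ?thesis by (simp add: bnd_def order.trans[of _ 0])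
qed

text \<open>\<open>signed_take_bit\<close> commutes with the bitwise operations, so in this form it
  is immediate that they do not leave the range.\<close>

lemma bnd_iff_signed_take_bit: "bnd m x \<longleftrightarrow> signed_take_bit m x = x"
  by (simp add: bnd_def signed_take_bit_int_eq_self_iff)

lemma signed_take_bit_and: "signed_take_bit m (and x y) = and (signed_take_bit m x) (signed_take_bit m (y :: int))"
  and signed_take_bit_or: "signed_take_bit m (or x y) = or (signed_take_bit m x) (signed_take_bit m y)"
  and signed_take_bit_xor: "signed_take_bit m (xor x y) = xor (signed_take_bit m x) (signed_take_bit m y)"
  by (auto intro!: bit_eqI simp: bit_simps)

lemma abs_div_le: "\<bar>x div y\<bar> \<le> \<bar>x :: int\<bar>"
proof -
  have pos: "\<bar>x div y\<bar> \<le> \<bar>x\<bar>" if "0 < y" for x y :: int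
  proof (cases "0 \<le> x")
    case True
    then show ?thesis
      using that zdiv_mono2[of x 1 y] pos_imp_zdiv_nonneg_iff[OF that, of x] by simp
  next
    case False
    then show ?thesis
      using that zdiv_mono2_neg[of x 1 y] pos_imp_zdiv_neg_iff[OF that, of x] by simp
  qed
  consider "y = 0" | "0 < y" | "y < 0" by linarith
  then show ?thesis
  proof cases
    case 3
    then show ?thesis using pos[of "- y" "- x"] by simp
  qed (use pos in simp_all)
qed

text \<open>Multiplication dictates the sum \<open>p + q\<close>; the extra 1 is due to the product
  of \<open>- (2 ^ p)\<close> and \<open>- (2 ^ q)\<close>, which just misses the strict upper bound
  of \<open>bnd (p + q)\<close>. One bound is taken for all operations so that it can be iterated
  over an expression.\<close>

lemma bnd_binop:
  assumes x: "bnd p x" and y: "bnd q y"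
  shows "bnd (p + q + 1) (binop_val f x y)"
proof -
  define m where "m = max p q"
  have mx: "bnd m x" "bnd m y" using x y by (auto simp: m_def intro: bnd_mono)
  have m: "m \<le> p + q" by (simp add: m_def)
  have two: "bnd (p + q + 1) z" if "- (2 * 2 ^ m) \<le> z" "z < 2 * 2 ^ m" for z
    by (rule bnd_mono[of "m + 1"]) (use that m in \<open>auto simp: bnd_def\<close>)
  have one: "bnd (p + q + 1) z" if "bnd m z" for z
    by (rule bnd_mono[OF that]) (use m in simp)
  have bit01: "bnd (p + q + 1) (of_bool c)" for c
  proof (rule two)
    have "(0 :: int) < 2 ^ m" by simp
    then show "- (2 * 2 ^ m) \<le> (of_bool c :: int)" "(of_bool c :: int) < 2 * 2 ^ m"
      unfolding of_bool_def by (auto simp del: zero_less_power)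
  qed
  show ?thesis
  proof (cases f)
    case Add
    show ?thesis unfolding Add binop_val.simps
      by (rule two) (use mx in \<open>simp_all add: bnd_def\<close>)
  next
    case Sub
    show ?thesis unfolding Sub binop_val.simps
      by (rule two) (use mx in \<open>simp_all add: bnd_def\<close>)
  next
    case Mul
    have "\<bar>x\<bar> \<le> 2 ^ p" "\<bar>y\<bar> \<le> 2 ^ q" using x y by (auto simp: bnd_def)
    then have "\<bar>x\<bar> * \<bar>y\<bar> \<le> 2 ^ p * 2 ^ q" by (intro mult_mono) auto
    then have "\<bar>x * y\<bar> \<le> 2 ^ (p + q)" by (simp add: abs_mult power_add)
    moreover have "(0 :: int) < 2 ^ (p + q)" by simp
    ultimately have "- (2 * 2 ^ (p + q)) \<le> x * y" "x * y < 2 * 2 ^ (p + q)" by linarith+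
    then show ?thesis by (simp add: Mul bnd_def)
  next
    case Div
    have "\<bar>x div y\<bar> \<le> 2 ^ m" using abs_div_le[of x y] mx(1) by (auto simp: bnd_def)
    moreover have "(0 :: int) < 2 ^ m" by simp
    ultimately have "- (2 * 2 ^ m) \<le> x div y" "x div y < 2 * 2 ^ m" by linarith+
    then show ?thesis by (simp only: Div binop_val.simps two)
  next
    case Mod
    have "bnd m (x mod y)"
    proof (cases "y = 0")
      case False
      then consider "0 < y" | "y < 0" by linarith
      then show ?thesis
      proof cases
        case 1
        then have "0 \<le> x mod y" "x mod y < y" by simp_all
        then show ?thesis using mx(2) by (simp add: bnd_def order.trans[of _ 0])
      next
        case 2
        then have "x mod y \<le> 0" "y < x mod y" by simp_all
        moreover have "(0 :: int) < 2 ^ m" by simp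
        ultimately show ?thesis using mx(2) unfolding bnd_def by linarith
      qed
    qed (use mx in simp)
    then show ?thesis using one Mod by simp
  next
    case And
    have "bnd m (and x y)" using mx unfolding bnd_iff_signed_take_bit
      by (simp add: signed_take_bit_and)
    then show ?thesis using one And by simp
  next
    case Or
    have "bnd m (or x y)" using mx unfolding bnd_iff_signed_take_bit
      by (simp add: signed_take_bit_or)
    then show ?thesis using one Or by simp
  next
    case Xor
    have "bnd m (xor x y)" using mx unfolding bnd_iff_signed_take_bit
      by (simp add: signed_take_bit_xor)
    then show ?thesis using one Xor by simp
  next
    case Lt
    then show ?thesis by (simp only: binop_val.simps bit01)
  next
    case Eq
    then show ?thesis by (simp only: binop_val.simps bit01)
  qed
qed

text \<open>
  If all registers and cells hold \<open>b\<close>-bit numbers, then so does, up to a constant factor in the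
  number of bits, every intermediate result of an expression of bounded size. Hence it suffices to
  bound the values that are stored.
\<close>

primrec small_consts :: "exp \<Rightarrow> bool" where
  "small_consts (Const c) \<longleftrightarrow> \<bar>c\<bar> \<le> 8"
| "small_consts (Reg r) \<longleftrightarrow> True"
| "small_consts (Load e) \<longleftrightarrow> small_consts e"
| "small_consts (Bin f e1 e2) \<longleftrightarrow> small_consts e1 \<and> small_consts e2"

text \<open>40 is the factor of \<open>b\<close> in the locale \<open>word_ram\<close>. Constants up
  to 8, the stride of the interleaved arrays, fit because \<open>4 \<le> b\<close>.\<close>

definition small_exp :: "exp \<Rightarrow> bool" where
  "small_exp e \<longleftrightarrow> small_consts e \<and> exp_cost e \<le> 40"

primrec small_com :: "com \<Rightarrow> bool" where
  "small_com Skip \<longleftrightarrow> True"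
| "small_com (Assign r e) \<longleftrightarrow> small_exp e"
| "small_com (Store a e) \<longleftrightarrow> small_exp a \<and> small_exp e"
| "small_com (Seq c1 c2) \<longleftrightarrow> small_com c1 \<and> small_com c2"
| "small_com (If e c1 c2) \<longleftrightarrow> small_exp e \<and> small_com c1 \<and> small_com c2"
| "small_com (While e c) \<longleftrightarrow> small_exp e \<and> small_com c"

definition For :: "nat \<Rightarrow> exp \<Rightarrow> com \<Rightarrow> com" where
  "For r e c = Seq (Assign r (Const 0))
     (While (Bin Lt (Reg r) e) (Seq c (Assign r (Bin Add (Reg r) (Const 1)))))"

lemma small_com_For [simp]: "small_com (For r e c) \<longleftrightarrow> small_consts e \<and> exp_cost e \<le> 38 \<and> small_com c"
  by (auto simp: For_def small_exp_def)

definition ok :: "nat \<Rightarrow> state \<Rightarrow> bool" where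
  "ok b s \<longleftrightarrow> (\<forall>r. bnd b (regs s r)) \<and> (\<forall>a. bnd b (mem s a))"

locale word_ram =
  fixes w b :: nat
  assumes b: "4 \<le> b" and w: "40 * b + 1 \<le> w"
begin

lemma bnd_exp:
  assumes s: "ok b s" and e: "small_consts e"
  shows "bnd (exp_cost e * b) (exp_val e s)"
  using e
proof (induction e)
  case (Const c)
  have "(2 :: int) ^ 4 \<le> 2 ^ b" using b by (intro power_increasing) auto
  then show ?case using Const by (auto simp: bnd_def)
next
  case (Reg r)
  then show ?case using s by (simp add: ok_def)
next
  case (Load e)
  have "bnd b (mem s (exp_val e s))" using s by (simp add: ok_def)
  then show ?case unfolding exp_val.simps by (rule bnd_mono) simp
next
  case (Bin f e1 e2)
  have "bnd (exp_cost e1 * b + exp_cost e2 * b + 1) (exp_val (Bin f e1 e2) s)"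
    using Bin bnd_binop by simp
  \<comment> \<open>The extra bit of \<open>bnd_binop\<close> is paid for by the unit cost of the
    operator node.\<close>
  then show ?case by (rule bnd_mono) (use b in \<open>simp add: algebra_simps\<close>)
qed

lemma fits_exp:
  assumes s: "ok b s" and e: "small_consts e" "exp_cost e \<le> 40"
  shows "fits w (exp_val e s)"
proof -
  have "exp_cost e * b \<le> 40 * b" using e(2) by (rule mult_right_mono) simp
  then have "bnd (w - 1) (exp_val e s)"
    using w by (intro bnd_mono[OF bnd_exp[OF s e(1)]]) linarith
  moreover have "(2 :: int) ^ w = 2 * 2 ^ (w - 1)" using w by (simp flip: power_Suc)
  ultimately show ?thesis by (simp add: fits_def bnd_def)
qed

lemma exp_fits:
  assumes s: "ok b s" and e: "small_exp e"
  shows "exp_fits w e s"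
proof -
  have "small_consts e" "exp_cost e \<le> 40" using e by (auto simp: small_exp_def)
  then show ?thesis
  proof (induction e)
    case (Const c)
    then show ?case using fits_exp[OF s, of "Const c"] by simp
  next
    case (Reg r)
    then show ?case using fits_exp[OF s, of "Reg r"] by simp
  next
    case (Load e)
    then show ?case using fits_exp[OF s, of "Load e"] by simp
  next
    case (Bin f e1 e2)
    then show ?case using fits_exp[OF s, of "Bin f e1 e2"] by simp
  qed
qed

text \<open>A weakest precondition whose postcondition also sees the elapsed time. Size obligations
  arise only for stored values, \<open>ok b\<close> being carried along by \<open>vc_sound\<close>.
  The loop clause is the semantics itself; loops are handled through \<open>vc_For\<close>.\<close>

primrec vc :: "com \<Rightarrow> (nat \<Rightarrow> state \<Rightarrow> bool) \<Rightarrow> state \<Rightarrow> bool" where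
  "vc Skip Q s \<longleftrightarrow> Q 1 s"
| "vc (Assign r e) Q s \<longleftrightarrow> bnd b (exp_val e s) \<and>
     Q (exp_cost e + 1) (s\<lparr>regs := (regs s)(r := exp_val e s)\<rparr>)"
| "vc (Store a e) Q s \<longleftrightarrow> bnd b (exp_val e s) \<and>
     Q (exp_cost a + exp_cost e + 1) (s\<lparr>mem := (mem s)(exp_val a s := exp_val e s)\<rparr>)"
| "vc (Seq c1 c2) Q s \<longleftrightarrow> vc c1 (\<lambda>t1. vc c2 (\<lambda>t2. Q (t1 + t2))) s"
| "vc (If e c1 c2) Q s \<longleftrightarrow>
     (exp_val e s \<noteq> 0 \<longrightarrow> vc c1 (\<lambda>t. Q (exp_cost e + 1 + t)) s) \<and>
     (exp_val e s = 0 \<longrightarrow> vc c2 (\<lambda>t. Q (exp_cost e + 1 + t)) s)"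
| "vc (While e c) Q s \<longleftrightarrow> (ok b s \<longrightarrow> (\<exists>t s'. exec w (While e c) s t s' \<and> ok b s' \<and> Q t s'))"

lemma vc_sound:
  assumes "ok b s" "small_com c" "vc c Q s"
  shows "\<exists>t s'. exec w c s t s' \<and> ok b s' \<and> Q t s'"
  using assms
proof (induction c arbitrary: Q s)
  case Skip
  then show ?case using exec.Skip by fastforce
next
  case (Assign r e)
  then have "ok b (s\<lparr>regs := (regs s)(r := exp_val e s)\<rparr>)" by (auto simp: ok_def)
  then show ?case using Assign exec.Assign[OF exp_fits[OF Assign.prems(1)], of e r] by auto
next
  case (Store a e)
  then have "ok b (s\<lparr>mem := (mem s)(exp_val a s := exp_val e s)\<rparr>)" by (auto simp: ok_def)
  then show ?case
    using Store exec.Store[OF exp_fits[OF Store.prems(1)] exp_fits[OF Store.prems(1)], of a e] by auto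
next
  case (Seq c1 c2)
  have "\<exists>t s'. exec w c1 s t s' \<and> ok b s' \<and> vc c2 (\<lambda>t2. Q (t + t2)) s'"
    using Seq.prems by (intro Seq.IH(1)) auto
  then obtain t1 s1 where 1: "exec w c1 s t1 s1" "ok b s1" "vc c2 (\<lambda>t2. Q (t1 + t2)) s1" by blast
  have "\<exists>t s'. exec w c2 s1 t s' \<and> ok b s' \<and> Q (t1 + t) s'"
    using Seq.prems 1 by (intro Seq.IH(2)) auto
  then show ?case using exec.Seq[OF 1(1)] by blast
next
  case (If e c1 c2)
  have f: "exp_fits w e s" using If.prems by (auto intro: exp_fits)
  show ?case
  proof (cases "exp_val e s = 0")
    case True
    have "\<exists>t s'. exec w c2 s t s' \<and> ok b s' \<and> Q (exp_cost e + 1 + t) s'"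
      using If.prems True by (intro If.IH(2)) auto
    then show ?thesis using exec.IfFalse[OF f True] by blast
  next
    case False
    have "\<exists>t s'. exec w c1 s t s' \<and> ok b s' \<and> Q (exp_cost e + 1 + t) s'"
      using If.prems False by (intro If.IH(1)) auto
    then show ?thesis using exec.IfTrue[OF f False] by blast
  qed
next
  case (While e c)
  then show ?case by simp
qed

lemma vc_mono: "vc c Q s \<Longrightarrow> (\<And>t s'. Q t s' \<Longrightarrow> Q' t s') \<Longrightarrow> vc c Q' s"
proof (induction c arbitrary: Q Q' s)
  case (Seq c1 c2)
  show ?case using Seq.prems(1) unfolding vc.simps
    by (rule Seq.IH(1)) (erule Seq.IH(2), erule Seq.prems(2))
next
  case (If e c1 c2)
  have "vc c1 (\<lambda>t. Q' (exp_cost e + 1 + t)) s" if "vc c1 (\<lambda>t. Q (exp_cost e + 1 + t)) s"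
    by (rule If.IH(1)[OF that]) (rule If.prems(2))
  moreover have "vc c2 (\<lambda>t. Q' (exp_cost e + 1 + t)) s" if "vc c2 (\<lambda>t. Q (exp_cost e + 1 + t)) s"
    by (rule If.IH(2)[OF that]) (rule If.prems(2))
  ultimately show ?case using If.prems(1) by simp
next
  case (While e c)
  then show ?case unfolding vc.simps by blast
qed auto

text \<open>One iteration costs at most \<open>T\<close> for the body, 4 for the increment and
  \<open>exp_cost e + 3\<close> for the test; the extra round in \<open>m + 1\<close> pays for the
  initial assignment and the failing last test. As \<open>e\<close> is evaluated anew in every
  round, the invariant has to fix its value.\<close>

lemma vc_For:
  assumes small: "small_com (For r e c)" and m: "m < 2 ^ b"
    and init: "I 0 (s\<lparr>regs := (regs s)(r := 0)\<rparr>)"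
    and inv: "\<And>i s. I i s \<Longrightarrow> i \<le> m \<Longrightarrow> regs s r = int i \<and> exp_val e s = int m"
    and step: "\<And>i s. I i s \<Longrightarrow> i < m \<Longrightarrow>
      vc c (\<lambda>t s'. t \<le> T \<and> regs s' r = int i \<and> I (Suc i) (s'\<lparr>regs := (regs s')(r := int (Suc i))\<rparr>)) s"
    and post: "\<And>t s'. I m s' \<Longrightarrow> t \<le> (m + 1) * (T + exp_cost e + 9) \<Longrightarrow> Q t s'"
  shows "vc (For r e c) Q s"
proof -
  let ?W = "While (Bin Lt (Reg r) e) (Seq c (Assign r (Bin Add (Reg r) (Const 1))))"
  let ?c = "Seq c (Assign r (Bin Add (Reg r) (Const 1)))"
  have se: "small_exp (Bin Lt (Reg r) e)" and sc: "small_com ?c"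
    using small by (auto simp: small_exp_def)
  have body: "\<exists>t s'. exec w ?c s t s' \<and> ok b s' \<and> t \<le> T + 4 \<and> I (Suc i) s'"
    if "ok b s" "I i s" "i < m" for i s
  proof (rule vc_sound[OF that(1) sc])
    have "Suc i < 2 ^ b" using m that(3) by simp
    then have "bnd b (int (Suc i))" by (rule bnd_natI)
    then have *: "bnd b (1 + int i)" by simp
    show "vc ?c (\<lambda>t s'. t \<le> T + 4 \<and> I (Suc i) s') s"
      unfolding vc.simps
      by (rule vc_mono[OF step[OF that(2,3)]]) (auto simp: * add.commute)
  qed
  have loop: "\<exists>t s'. exec w ?W s t s' \<and> ok b s' \<and> t \<le> j * (T + exp_cost e + 7) + exp_cost e + 3 \<and> I m s'"
    if "ok b s" "I (m - j) s" "j \<le> m" for j s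
    using that
  proof (induction j arbitrary: s)
    case 0
    then have "exp_val (Bin Lt (Reg r) e) s = 0" using inv[of m s] by simp
    then have "exec w ?W s (exp_cost (Bin Lt (Reg r) e) + 1) s"
      by (rule exec.WhileFalse[OF exp_fits[OF 0(1) se]])
    then show ?case using 0 by (intro exI[of _ "exp_cost (Bin Lt (Reg r) e) + 1"] exI[of _ s]) auto
  next
    case (Suc j)
    have "exp_val (Bin Lt (Reg r) e) s \<noteq> 0" using inv[OF Suc.prems(2)] Suc.prems(3) by simp
    note while = exec.WhileTrue[OF exp_fits[OF Suc.prems(1) se] this]
    obtain t1 s1 where 1: "exec w ?c s t1 s1" "ok b s1" "t1 \<le> T + 4" "I (Suc (m - Suc j)) s1"
      using body[OF Suc.prems(1,2)] Suc.prems(3) by auto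
    then have "I (m - j) s1" using Suc.prems(3) by (simp add: Suc_diff_Suc)
    from Suc.IH[OF 1(2) this] Suc.prems(3) obtain t2 s2 where
      2: "exec w ?W s1 t2 s2" "ok b s2" "t2 \<le> j * (T + exp_cost e + 7) + exp_cost e + 3" "I m s2"
      by auto
    from while[OF 1(1) 2(1)] show ?case
      by (rule_tac exI, rule_tac exI, intro conjI, assumption) (use 1 2 in auto)
  qed
  have "\<exists>t s'. exec w ?W (s\<lparr>regs := (regs s)(r := 0)\<rparr>) t s' \<and> ok b s' \<and> Q (2 + t) s'"
    if o: "ok b (s\<lparr>regs := (regs s)(r := 0)\<rparr>)"
  proof -
    from loop[OF o, of m] init obtain t s' where
      1: "exec w ?W (s\<lparr>regs := (regs s)(r := 0)\<rparr>) t s'" "ok b s'"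
        "t \<le> m * (T + exp_cost e + 7) + exp_cost e + 3" "I m s'"
      by auto
    have "2 + t \<le> (m + 1) * (T + exp_cost e + 9)" using 1(3) by (simp add: algebra_simps)
    then show ?thesis using 1 post by blast
  qed
  moreover have "bnd b 0" by (simp add: bnd_def)
  ultimately show ?thesis unfolding For_def by (simp add: numeral_eq_Suc del: exec.intros)
qed

end


section \<open>The program\<close>

text \<open>
  Six arrays are interleaved at the negative addresses, so that they do not meet the adjacency matrix.
  Array 1 holds the powers of 2, array 2 the neighbourhoods of the vertices as bit masks, array 3
  the number of cliques inside each mask, array 4 the number of tuples of cliques, array 5 the
  masks reachable by elimination, and array 6 the reachability matrix of the current mask.
\<close>

definition cell :: "int \<Rightarrow> int \<Rightarrow> int" where "cell c x = - c - 8 * x"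

definition Cell :: "int \<Rightarrow> exp \<Rightarrow> exp" where
  "Cell c e = Bin Sub (Const (- c)) (Bin Mul (Const 8) e)"

definition Test_bit :: "exp \<Rightarrow> exp \<Rightarrow> exp" where
  "Test_bit e i = Bin Mod (Bin Div e (Load (Cell 1 i))) (Const 2)"

lemma exp_val_Cell [simp]: "exp_val (Cell c e) s = cell c (exp_val e s)"
  and exp_cost_Cell [simp]: "exp_cost (Cell c e) = exp_cost e + 4"
  and small_consts_Cell [simp]: "small_consts (Cell c e) \<longleftrightarrow> \<bar>c\<bar> \<le> 8 \<and> small_consts e"
  by (auto simp: Cell_def cell_def)

lemma exp_cost_Test_bit [simp]: "exp_cost (Test_bit e i) = exp_cost e + exp_cost i + 8"
  and small_consts_Test_bit [simp]: "small_consts (Test_bit e i) \<longleftrightarrow> small_consts e \<and> small_consts i"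
  by (auto simp: Test_bit_def)

lemma exp_val_Test_bit:
  assumes "exp_val e s = int x" "mem s (cell 1 (exp_val i s)) = 2 ^ j"
  shows "exp_val (Test_bit e i) s = of_bool (bit x j)"
  using assms by (simp add: Test_bit_def bit_nat_eq)

lemma cell_eq_iff [simp]:
  assumes "1 \<le> c" "c \<le> 7" "1 \<le> c'" "c' \<le> 7"
  shows "cell c x = cell c' y \<longleftrightarrow> c = c' \<and> x = y"
  unfolding cell_def using assms by presburger

lemma cell_neq_nonneg [simp]:
  assumes "0 \<le> a" "1 \<le> c"
  shows "a \<noteq> cell c (int x)" "cell c (int x) \<noteq> a"
  using assms by (auto simp: cell_def)

text \<open>Entry \<open>n\<close> is filled as well: \<open>2 ^ n\<close> bounds the loops over
  masks and gives the index of the full mask.\<close>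

definition powers_prog :: com where
  "powers_prog = Seq (Assign 4 (Const 1)) (For 2 (Bin Add (Reg 0) (Const 1))
     (Seq (Store (Cell 1 (Reg 2)) (Reg 4)) (Assign 4 (Bin Add (Reg 4) (Reg 4)))))"

definition nbrs_prog :: com where
  "nbrs_prog = For 2 (Reg 0) (Seq (Assign 4 (Const 0)) (Seq
     (For 5 (Reg 0) (If (Load (Bin Add (Bin Mul (Reg 2) (Reg 0)) (Reg 5)))
       (Assign 4 (Bin Or (Reg 4) (Load (Cell 1 (Reg 5))))) Skip))
     (Store (Cell 2 (Reg 2)) (Reg 4))))"

definition cliques_prog :: com where
  "cliques_prog = Seq (Store (Cell 3 (Const 0)) (Const 1)) (For 2 (Reg 0) (For 3 (Load (Cell 1 (Reg 2)))
     (Store (Cell 3 (Bin Add (Reg 3) (Load (Cell 1 (Reg 2)))))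
        (Bin Add (Load (Cell 3 (Reg 3))) (Load (Cell 3 (Bin And (Reg 3) (Load (Cell 2 (Reg 2))))))))))"

definition tuples_prog :: com where
  "tuples_prog = For 3 (Load (Cell 1 (Reg 0))) (Seq (Assign 4 (Const 1)) (Seq
     (For 5 (Reg 1) (Assign 4 (Bin Mul (Reg 4) (Load (Cell 3 (Reg 3))))))
     (Store (Cell 4 (Reg 3)) (Reg 4))))"

definition moebius_prog :: com where
  "moebius_prog = For 2 (Reg 0) (For 3 (Load (Cell 1 (Reg 0))) (If (Test_bit (Reg 3) (Reg 2))
     (Store (Cell 4 (Reg 3))
       (Bin Sub (Load (Cell 4 (Reg 3))) (Load (Cell 4 (Bin Sub (Reg 3) (Load (Cell 1 (Reg 2))))))))
     Skip))"

definition warshall_prog :: com where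
  "warshall_prog = Seq
     (For 5 (Reg 0) (Store (Cell 6 (Reg 5)) (Load (Cell 2 (Reg 5)))))
     (For 6 (Reg 0) (If (Test_bit (Reg 3) (Reg 6))
       (For 5 (Reg 0) (If (Test_bit (Load (Cell 6 (Reg 5))) (Reg 6))
         (Store (Cell 6 (Reg 5)) (Bin Or (Load (Cell 6 (Reg 5))) (Load (Cell 6 (Reg 6)))))
         Skip))
       Skip))"

definition steps_prog :: com where
  "steps_prog = For 5 (Reg 0) (If (Test_bit (Reg 3) (Reg 5)) Skip (Seq
     (Assign 4 (Bin Or
       (Bin Xor (Load (Cell 6 (Reg 5))) (Bin And (Load (Cell 6 (Reg 5))) (Reg 3)))
       (Load (Cell 1 (Reg 5)))))
     (If (Load (Cell 4 (Reg 4)))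
       (Store (Cell 5 (Bin Add (Reg 3) (Load (Cell 1 (Reg 5))))) (Const 1))
       Skip)))"

definition elim_prog :: com where
  "elim_prog = Seq (Store (Cell 5 (Const 0)) (Const 1)) (For 3 (Load (Cell 1 (Reg 0)))
     (If (Load (Cell 5 (Reg 3))) (Seq warshall_prog steps_prog) Skip))"

definition main_prog :: com where
  "main_prog = Seq powers_prog (Seq nbrs_prog (Seq cliques_prog (Seq tuples_prog (Seq moebius_prog
     (Seq elim_prog (Assign 0 (Load (Cell 5 (Bin Sub (Load (Cell 1 (Reg 0))) (Const 1))))))))))"

lemma small_com_main: "small_com main_prog"
  by (simp add: main_prog_def powers_prog_def nbrs_prog_def cliques_prog_def tuples_prog_def
      moebius_prog_def warshall_prog_def steps_prog_def elim_prog_def small_exp_def)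

definition elim_time :: "nat \<Rightarrow> nat" where
  "elim_time n = (n + 1) * 220 + (n + 1) * (140 * (n + 1) + 10) + 20"

text \<open>One summand per phase of the program; the final 100 collects the costs outside the
  loops.\<close>

definition main_time :: "nat \<Rightarrow> nat" where
  "main_time n = (n + 2) * 112 + (n + 1) * (130 * (n + 1) + 10) + (n + 1) * ((2 ^ n + 1) * 115 + 10) +
     (2 ^ n + 1) * (130 * (n + 1) + 15) + (n + 1) * ((2 ^ n + 1) * 115 + 10) +
     (2 ^ n + 1) * (elim_time n + 15) + 100"

section \<open>Correctness of the phases that fill the tables\<close>

locale tcl_program = word_ram w b for w b +
  fixes n k :: nat and E :: "nat set set"
  assumes sg: "simple_graph ({..<n}, E)" and kn: "k \<le> n" and nb: "n * n + n + 4 \<le> b"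
begin

abbreviation G :: "nat graph" where "G \<equiv> ({..<n}, E)"

definition nbrs :: "nat \<Rightarrow> nat set" where "nbrs v = {u. {v, u} \<in> E}"

definition base :: "state \<Rightarrow> bool" where
  "base s \<longleftrightarrow> regs s 0 = int n \<and> regs s 1 = int k \<and> (\<forall>i\<le>n. mem s (cell 1 (int i)) = 2 ^ i)"

definition input_mem :: "state \<Rightarrow> bool" where
  "input_mem s \<longleftrightarrow> (\<forall>a\<ge>0. mem s a = mem (input_state n E (int k)) a)"

definition nbr_tab :: "state \<Rightarrow> bool" where
  "nbr_tab s \<longleftrightarrow> (\<forall>i<n. mem s (cell 2 (int i)) = int (code (nbrs i)))"

definition clique_tab :: "nat \<Rightarrow> state \<Rightarrow> bool" where
  "clique_tab m s \<longleftrightarrow> (\<forall>y<m. mem s (cell 3 (int y)) = int (card (cliques_in G (bits y))))"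

text \<open>Stage \<open>i\<close> of the transform, in which only vertices below \<open>i\<close>
  are required to be covered. Stage 0 is a power, and stage \<open>n\<close> decides coverability of
  the masks below \<open>2 ^ n\<close>.\<close>

definition tuple_count :: "nat \<Rightarrow> nat \<Rightarrow> nat" where
  "tuple_count i y = card (clique_tuples G k (bits y) (bits y \<inter> {..<i}))"

text \<open>
  An update in place: the entries below \<open>m\<close> are already at stage \<open>i\<close>, the others still at stage \<open>i'\<close>.
  The same convention is used for \<open>warshall_tab\<close>.
\<close>

definition tuple_tab :: "nat \<Rightarrow> nat \<Rightarrow> nat \<Rightarrow> state \<Rightarrow> bool" where
  "tuple_tab m i i' s \<longleftrightarrow>
     (\<forall>y<2 ^ n. mem s (cell 4 (int y)) = int (tuple_count (if y < m then i else i') y))"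

text \<open>The program never clears the flags in array 5; their initial zeros are carried through
  all phases before the elimination.\<close>

definition zero5 :: "state \<Rightarrow> bool" where
  "zero5 s \<longleftrightarrow> (\<forall>y :: nat. mem s (cell 5 (int y)) = 0)"

lemma nbrs_subset: "nbrs v \<subseteq> {..<n}"
  using sg by (auto simp: nbrs_def simple_graph_def)

lemma finite_nbrs [simp]: "finite (nbrs v)"
  using nbrs_subset finite_subset by blast

lemma bnd_int: "x \<le> 2 ^ (n * n + n + 2) \<Longrightarrow> bnd b (int x)"
proof (rule bnd_natI)
  have "(2 :: nat) ^ (n * n + n + 2) < 2 ^ b" using nb by (intro power_strict_increasing) auto
  then show "x \<le> 2 ^ (n * n + n + 2) \<Longrightarrow> x < 2 ^ b" by simp
qed

lemma bnd_exp2: "i \<le> n + 2 \<Longrightarrow> bnd b (2 ^ i)"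
proof -
  assume "i \<le> n + 2"
  then have "(2 :: nat) ^ i \<le> 2 ^ (n * n + n + 2)" by (intro power_increasing) auto
  then show ?thesis using bnd_int[of "2 ^ i"] by simp
qed

lemma exp2_less: "2 ^ n < (2 :: nat) ^ b" "i \<le> n \<Longrightarrow> (2 :: nat) ^ i < 2 ^ b" "n < 2 ^ b" "Suc n < 2 ^ b" "k < 2 ^ b"
proof -
  have "i \<le> n + 1 \<Longrightarrow> (2 :: nat) ^ i < 2 ^ b" for i using nb by (intro power_strict_increasing) auto
  moreover from this[of "n + 1"] have "Suc n < 2 ^ b" using less_exp[of "n + 1"] by (simp only: Suc_eq_plus1) linarith
  ultimately show "2 ^ n < (2 :: nat) ^ b" "i \<le> n \<Longrightarrow> (2 :: nat) ^ i < 2 ^ b" "n < 2 ^ b" "Suc n < 2 ^ b" "k < 2 ^ b"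
    using kn by auto
qed

lemma powers_correct:
  assumes "regs s 0 = int n" "regs s 1 = int k" "input_mem s" "zero5 s"
  shows "vc powers_prog (\<lambda>t s'. t \<le> (n + 2) * 112 + 2 \<and> base s' \<and> input_mem s' \<and> zero5 s') s"
proof -
  let ?I = "\<lambda>i s. regs s 0 = int n \<and> regs s 1 = int k \<and> input_mem s \<and> zero5 s \<and>
    (\<forall>j<i. mem s (cell 1 (int j)) = 2 ^ j) \<and> regs s 4 = 2 ^ i \<and> regs s 2 = int i"
  show ?thesis
    unfolding powers_prog_def vc.simps
  proof (intro conjI, goal_cases)
    case 1
    then show ?case using bnd_exp2[of 0] by simp
  next
    case 2
    show ?case
    proof (rule vc_For[where m = "n + 1" and T = 100 and I = ?I], goal_cases)
      case 1
      then show ?case by (simp add: small_exp_def)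
    next
      case 2
      then show ?case using exp2_less by simp
    next
      case 3
      then show ?case using assms by (simp add: input_mem_def zero5_def)
    next
      case (4 i s)
      then show ?case by simp
    next
      case (5 i s)
      have "bnd b (2 * 2 ^ i)" using bnd_exp2[of "Suc i"] 5 by simp
      moreover have "bnd b (2 ^ i)" using bnd_exp2[of i] 5 by simp
      ultimately show ?case using 5 by (auto simp: less_Suc_eq input_mem_def zero5_def)
    next
      case (6 t s)
      then show ?case by (auto simp: base_def less_Suc_eq_le)
    qed
  qed
qed

lemma input_mem_adj:
  assumes "input_mem s" "i < n" "j < n"
  shows "mem s (int i * int n + int j) = of_bool ({i, j} \<in> E)"
proof -
  have eq: "i' = i \<and> j' = j" if "i' * n + j' = i * n + j" "j' < n" for i' j'
  proof -
    have "(i' * n + j') div n = i'" "(i' * n + j') mod n = j'"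
      "(i * n + j) div n = i" "(i * n + j) mod n = j" using that(2) assms(3) by auto
    then show ?thesis using that(1) by metis
  qed
  have "(\<exists>i'<n. \<exists>j'<n. int (i * n + j) = int (i' * n + j') \<and> {i', j'} \<in> E) \<longleftrightarrow> {i, j} \<in> E"
    unfolding of_nat_eq_iff using eq assms(2,3) by metis
  then have "mem (input_state n E (int k)) (int (i * n + j)) = of_bool ({i, j} \<in> E)"
    by (simp only: input_state_def state.simps)
  then show ?thesis using assms(1) by (simp add: input_mem_def)
qed

lemma nbrs_correct:
  assumes "base s" "input_mem s" "zero5 s"
  shows "vc nbrs_prog (\<lambda>t s'. t \<le> (n + 1) * (130 * (n + 1) + 10) \<and> base s' \<and> nbr_tab s' \<and> zero5 s') s"
proof -
  let ?B = "\<lambda>i s. base s \<and> input_mem s \<and> zero5 s \<and>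
    (\<forall>v<i. mem s (cell 2 (int v)) = int (code (nbrs v))) \<and> regs s 2 = int i"
  let ?J = "\<lambda>i j s. ?B i s \<and> regs s 4 = int (code (nbrs i \<inter> {..<j})) \<and> regs s 5 = int j"
  have inner: "vc (For 5 (Reg 0) (If (Load (Bin Add (Bin Mul (Reg 2) (Reg 0)) (Reg 5)))
       (Assign 4 (Bin Or (Reg 4) (Load (Cell 1 (Reg 5))))) Skip))
     (\<lambda>t s'. t \<le> (n + 1) * 110 \<and> ?J i n s') s" if i: "i < n" and s: "?B i s" "regs s 4 = 0" for i s
  proof (rule vc_For[where m = n and T = 100 and I = "?J i"], goal_cases)
    case 1
    then show ?case by (simp add: small_exp_def)
  next
    case 2
    then show ?case by (rule exp2_less)
  next
    case 3
    then show ?case using s by (simp add: base_def input_mem_def zero5_def code_def)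
  next
    case (4 j s)
    then show ?case by (simp add: base_def)
  next
    case (5 j s)
    have adj: "mem s (int i * int n + int j) = of_bool ({i, j} \<in> E)"
      using 5 i by (intro input_mem_adj) auto
    have reg: "regs s 0 = int n" and p: "mem s (cell 1 (int j)) = 2 ^ j" using 5 by (auto simp: base_def)
    show ?case
    proof (cases "{i, j} \<in> E")
      case True
      have "or (int (code (nbrs i \<inter> {..<j}))) (2 ^ j) = int (or (code (nbrs i \<inter> {..<j})) (code {j}))"
        by (simp add: of_nat_or_eq flip: code_singleton)
      also have "\<dots> = int (code (nbrs i \<inter> {..<Suc j}))"
        using True by (subst code_or) (auto simp: nbrs_def intro!: arg_cong[of _ _ code])
      finally have "or (int (code (nbrs i \<inter> {..<j}))) (2 ^ j) = int (code (nbrs i \<inter> {..<Suc j}))" .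
      moreover have "bnd b (int (code (nbrs i \<inter> {..<Suc j})))"
      proof (rule bnd_int)
        have "code (nbrs i \<inter> {..<Suc j}) < 2 ^ n" using nbrs_subset[of i] by (intro code_less) auto
        also have "\<dots> \<le> 2 ^ (n * n + n + 2)" by (intro power_increasing) auto
        finally show "code (nbrs i \<inter> {..<Suc j}) \<le> 2 ^ (n * n + n + 2)" by simp
      qed
      ultimately show ?thesis using 5 adj True reg p by (simp add: base_def input_mem_def zero5_def)
    next
      case False
      then have "nbrs i \<inter> {..<Suc j} = nbrs i \<inter> {..<j}" by (auto simp: nbrs_def less_Suc_eq)
      then show ?thesis using 5 adj False reg p by (simp add: base_def input_mem_def zero5_def)
    qed
  next
    case (6 t s)
    then show ?case by simp
  qed
  show ?thesis
    unfolding nbrs_prog_def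
  proof (rule vc_For[where m = n and T = "130 * (n + 1)" and I = ?B], goal_cases)
    case 1
    then show ?case by (simp add: small_exp_def)
  next
    case 2
    then show ?case by (rule exp2_less)
  next
    case 3
    then show ?case using assms by (simp add: base_def input_mem_def zero5_def)
  next
    case (4 j s)
    then show ?case by (simp add: base_def)
  next
    case (5 i s)
    have "nbrs i \<inter> {..<n} = nbrs i" using nbrs_subset by auto
    moreover have "bnd b (int (code (nbrs i)))"
    proof (rule bnd_int)
      have "code (nbrs i) < 2 ^ n" using nbrs_subset[of i] by (rule code_less)
      also have "\<dots> \<le> 2 ^ (n * n + n + 2)" by (intro power_increasing) auto
      finally show "code (nbrs i) \<le> 2 ^ (n * n + n + 2)" by simp
    qed
    moreover have "bnd b 0" by (simp add: bnd_def)
    ultimately show ?case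
      unfolding vc.simps using 5
      by (intro conjI; (simp; fail)?)
        (rule vc_mono[OF inner[of i]];
          auto simp: base_def input_mem_def zero5_def less_Suc_eq)
  next
    case (6 t s)
    then show ?case by (simp add: nbr_tab_def)
  qed
qed

lemma card_bits_le: "y < 2 ^ n \<Longrightarrow> card (bits y) \<le> n"
  using card_mono[of "{..<n}" "bits y"] bits_subset_iff[of y n] by simp

lemma card_cliques_bits_le: "y < 2 ^ n \<Longrightarrow> card (cliques_in G (bits y)) \<le> 2 ^ n"
  using card_cliques_in_le[OF finite_bits, of G y] power_increasing[OF card_bits_le, of y "2 :: nat"]
  by linarith

lemma bnd_card_cliques: "y < 2 ^ n \<Longrightarrow> bnd b (int (card (cliques_in G (bits y))))"
proof (rule bnd_int)
  assume "y < 2 ^ n"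
  then have "card (cliques_in G (bits y)) \<le> 2 ^ n" by (rule card_cliques_bits_le)
  also have "\<dots> \<le> 2 ^ (n * n + n + 2)" by (intro power_increasing) auto
  finally show "card (cliques_in G (bits y)) \<le> 2 ^ (n * n + n + 2)" .
qed

lemma cliques_correct:
  assumes "base s" "nbr_tab s" "zero5 s"
  shows "vc cliques_prog (\<lambda>t s'. t \<le> (n + 1) * ((2 ^ n + 1) * 115 + 10) + 20 \<and>
    base s' \<and> nbr_tab s' \<and> zero5 s' \<and> clique_tab (2 ^ n) s') s"
proof -
  let ?B = "\<lambda>i m s. base s \<and> nbr_tab s \<and> zero5 s \<and> clique_tab m s \<and> regs s 2 = int i"
  have inner: "vc (For 3 (Load (Cell 1 (Reg 2)))
     (Store (Cell 3 (Bin Add (Reg 3) (Load (Cell 1 (Reg 2)))))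
        (Bin Add (Load (Cell 3 (Reg 3))) (Load (Cell 3 (Bin And (Reg 3) (Load (Cell 2 (Reg 2)))))))))
     (\<lambda>t s'. t \<le> (2 ^ n + 1) * 115 \<and> ?B i (2 ^ Suc i) s') s"
    if i: "i < n" and s: "?B i (2 ^ i) s" for i s
  proof (rule vc_For[where m = "2 ^ i" and T = 100 and I = "\<lambda>y s. ?B i (2 ^ i + y) s \<and> regs s 3 = int y"], goal_cases)
    case 1
    then show ?case by (simp add: small_exp_def)
  next
    case 2
    show ?case using i by (intro exp2_less(2)) simp
  next
    case 3
    then show ?case using s by (simp add: base_def nbr_tab_def zero5_def clique_tab_def)
  next
    case (4 j s)
    then show ?case using i by (simp add: base_def)
  next
    case (5 y s)
    \<comment> \<open>\<open>z\<close> encodes the neighbours of \<open>i\<close> inside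
      \<open>y\<close>; being a submask of \<open>y\<close> it is below \<open>2 ^ i\<close>, so its
      count is already in the table.\<close>
    define z where "z = and y (code (nbrs i))"
    have ilen: "(2 :: nat) ^ Suc i \<le> 2 ^ n" using i by (intro power_increasing) auto
    have by2: "bits y \<subseteq> {..<i}" using bits_subset_iff 5 by blast
    have bz: "bits z = bits y \<inter> nbrs i" by (simp add: z_def bits_and bits_code)
    then have "z < 2 ^ i" using bits_subset_iff by2 by blast
    moreover have "card (cliques_in G (bits (y + 2 ^ i))) =
        card (cliques_in G (bits y)) + card (cliques_in G (bits z))"
    proof -
      have "\<not> bit y i" using by2 by auto
      then show ?thesis using card_cliques_in_insert[of "bits y" i G] i
        by (simp add: bits_add bz nbrs_def)
    qed
    moreover have "bnd b (int (card (cliques_in G (bits (y + 2 ^ i)))))"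
      using 5 ilen by (intro bnd_card_cliques) simp
    moreover have "mem s (cell 1 (int i)) = 2 ^ i" "mem s (cell 2 (int i)) = int (code (nbrs i))"
      using 5 i by (auto simp: base_def nbr_tab_def)
    moreover have "and (int y) (int (code (nbrs i))) = int z" by (simp add: z_def of_nat_and_eq)
    moreover have "int y + 2 ^ i = int (y + 2 ^ i)" by simp
    ultimately show ?case using 5 unfolding clique_tab_def
      by (auto simp: base_def nbr_tab_def zero5_def less_Suc_eq add.commute simp del: of_nat_add of_nat_power)
        (simp flip: of_nat_add)
  next
    case (6 t s)
    have "t \<le> (2 ^ i + 1) * 115" using 6(2) by simp
    also have "\<dots> \<le> (2 ^ n + 1) * (115 :: nat)"
      using i by (intro mult_right_mono add_right_mono power_increasing) auto
    finally show ?case using 6(1) by (simp add: mult_2)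
  qed
  show ?thesis
    unfolding cliques_prog_def vc.simps
  proof (intro conjI, goal_cases)
    case 1
    then show ?case using bnd_exp2[of 0] by simp
  next
    case 2
    show ?case
    proof (rule vc_For[where m = n and T = "(2 ^ n + 1) * 115" and I = "\<lambda>i. ?B i (2 ^ i)"], goal_cases)
      case 1
      then show ?case by (simp add: small_exp_def)
    next
      case 2
      then show ?case by (rule exp2_less)
    next
      case 3
      then show ?case using assms by (simp add: base_def nbr_tab_def zero5_def clique_tab_def)
    next
      case (4 j s)
      then show ?case by (simp add: base_def)
    next
      case (5 i s)
      then have s: "?B i (2 ^ i) s" and i: "i < n" by auto
      show ?case
        by (rule vc_mono[OF inner[OF i s]]) (auto simp: base_def nbr_tab_def zero5_def clique_tab_def)
    next
      case (6 t s)
      then show ?case by simp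
    qed
  qed
qed

lemma tuple_count_le: "y < 2 ^ n \<Longrightarrow> tuple_count i y \<le> 2 ^ (n * n + n + 2)"
proof -
  assume y: "y < 2 ^ n"
  have "tuple_count i y \<le> (2 ^ card (bits y)) ^ k"
    unfolding tuple_count_def by (rule card_clique_tuples_le) simp
  also have "\<dots> = 2 ^ (card (bits y) * k)" by (simp add: power_mult)
  also have "\<dots> \<le> 2 ^ (n * n + n + 2)"
    using mult_mono[OF card_bits_le[OF y] kn] by (intro power_increasing) auto
  finally show ?thesis .
qed

lemma tuples_correct:
  assumes "base s" "nbr_tab s" "zero5 s" "clique_tab (2 ^ n) s"
  shows "vc tuples_prog (\<lambda>t s'. t \<le> (2 ^ n + 1) * (130 * (n + 1) + 15) \<and>
    base s' \<and> nbr_tab s' \<and> zero5 s' \<and> tuple_tab 0 0 0 s') s"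
proof -
  let ?B = "\<lambda>y s. base s \<and> nbr_tab s \<and> zero5 s \<and> clique_tab (2 ^ n) s \<and>
    (\<forall>z<y. mem s (cell 4 (int z)) = int (tuple_count 0 z)) \<and> regs s 3 = int y"
  have count0: "tuple_count 0 y = card (cliques_in G (bits y)) ^ k" for y
    by (simp add: tuple_count_def card_clique_tuples_empty)
  \<comment> \<open>The intermediate powers are stored too, so each of them needs a bound, not only
    the last one.\<close>
  have bnd_pow: "bnd b (int (card (cliques_in G (bits y)) ^ j))" if "y < 2 ^ n" "j \<le> n" for y j
  proof (rule bnd_int)
    have "card (cliques_in G (bits y)) ^ j \<le> (2 ^ n) ^ j"
      using card_cliques_bits_le[OF that(1)] by (rule power_mono) simp
    also have "\<dots> = 2 ^ (n * j)" by (simp add: power_mult)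
    also have "\<dots> \<le> 2 ^ (n * n + n + 2)"
      by (intro power_increasing) (use mult_le_mono2[OF that(2), of n] in linarith, simp)
    finally show "card (cliques_in G (bits y)) ^ j \<le> 2 ^ (n * n + n + 2)" .
  qed
  let ?J = "\<lambda>y j s. ?B y s \<and> regs s 4 = int (card (cliques_in G (bits y)) ^ j) \<and> regs s 5 = int j"
  have inner: "vc (For 5 (Reg 1) (Assign 4 (Bin Mul (Reg 4) (Load (Cell 3 (Reg 3))))))
     (\<lambda>t s'. t \<le> (n + 1) * 110 \<and> ?J y k s') s" if y: "y < 2 ^ n" and s: "?B y s" "regs s 4 = 1" for y s
  proof (rule vc_For[where m = k and T = 100 and I = "?J y"], goal_cases)
    case 1
    then show ?case by (simp add: small_exp_def)
  next
    case 2
    then show ?case by (rule exp2_less)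
  next
    case 3
    then show ?case using s by (simp add: base_def nbr_tab_def zero5_def clique_tab_def)
  next
    case (4 j s)
    then show ?case by (simp add: base_def)
  next
    case (5 j s)
    have "bnd b (int (card (cliques_in G (bits y)) ^ Suc j))" using y 5 kn by (intro bnd_pow) auto
    moreover have "mem s (cell 3 (int y)) = int (card (cliques_in G (bits y)))"
      using 5 y by (simp add: clique_tab_def)
    ultimately show ?case using 5
      by (simp add: base_def nbr_tab_def zero5_def clique_tab_def mult.commute)
  next
    case (6 t s)
    have "(k + 1) * 110 \<le> (n + 1) * 110" using kn by simp
    then show ?case using 6 by simp
  qed
  show ?thesis
    unfolding tuples_prog_def
  proof (rule vc_For[where m = "2 ^ n" and T = "130 * (n + 1)" and I = ?B], goal_cases)
    case 1
    then show ?case by (simp add: small_exp_def)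
  next
    case 2
    then show ?case by (rule exp2_less)
  next
    case 3
    then show ?case using assms by (simp add: base_def nbr_tab_def zero5_def clique_tab_def)
  next
    case (4 j s)
    then show ?case by (simp add: base_def)
  next
    case (5 y s)
    have "bnd b (int (card (cliques_in G (bits y)) ^ k))" using 5 kn by (intro bnd_pow) auto
    moreover have "bnd b 1" using bnd_exp2[of 0] by simp
    ultimately show ?case
      unfolding vc.simps using 5
      by (intro conjI; (simp; fail)?)
        (rule vc_mono[OF inner[of y]];
          auto simp: base_def nbr_tab_def zero5_def clique_tab_def less_Suc_eq count0)
  next
    case (6 t s)
    then show ?case by (simp add: tuple_tab_def)
  qed
qed

text \<open>The mask \<open>y - 2 ^ i\<close> lacks bit \<open>i\<close>, so its stages
  \<open>i\<close> and \<open>Suc i\<close> agree and the in-place update may read it after it has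
  been processed. The second fact keeps the subtraction of naturals from truncating, so that it
  matches the integer subtraction of the machine.\<close>

lemma tuple_count_Suc:
  "tuple_count (Suc i) y = (if bit y i then tuple_count i y - tuple_count (Suc i) (y - 2 ^ i) else tuple_count i y)"
  "bit y i \<Longrightarrow> tuple_count (Suc i) (y - 2 ^ i) \<le> tuple_count i y"
proof -
  have 1: "tuple_count i y = tuple_count (Suc i) y + tuple_count (Suc i) (y - 2 ^ i)" if "bit y i"
  proof -
    have "bits y \<inter> {..<Suc i} = insert i (bits y \<inter> {..<i})"
      "bits (y - 2 ^ i) \<inter> {..<Suc i} = bits y \<inter> {..<i}"
      using that by (auto simp: bits_sub simp del: mem_bits) (auto simp: less_Suc_eq)
    then show ?thesis unfolding tuple_count_def
      using card_clique_tuples_insert[of "bits y" i "bits y \<inter> {..<i}" G k] that by (simp add: bits_sub)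
  qed
  have 2: "tuple_count (Suc i) y = tuple_count i y" if "\<not> bit y i"
  proof -
    have "bits y \<inter> {..<Suc i} = bits y \<inter> {..<i}" using that by (auto simp: less_Suc_eq)
    then show ?thesis by (simp add: tuple_count_def)
  qed
  show "tuple_count (Suc i) y = (if bit y i then tuple_count i y - tuple_count (Suc i) (y - 2 ^ i) else tuple_count i y)"
    "bit y i \<Longrightarrow> tuple_count (Suc i) (y - 2 ^ i) \<le> tuple_count i y"
    using 1 2 by auto
qed

lemma moebius_correct:
  assumes "base s" "nbr_tab s" "zero5 s" "tuple_tab 0 0 0 s"
  shows "vc moebius_prog (\<lambda>t s'. t \<le> (n + 1) * ((2 ^ n + 1) * 115 + 10) \<and>
    base s' \<and> nbr_tab s' \<and> zero5 s' \<and> tuple_tab 0 n n s') s"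
proof -
  let ?B = "\<lambda>i s. base s \<and> nbr_tab s \<and> zero5 s \<and> regs s 2 = int i"
  have inner: "vc (For 3 (Load (Cell 1 (Reg 0))) (If (Test_bit (Reg 3) (Reg 2))
     (Store (Cell 4 (Reg 3))
       (Bin Sub (Load (Cell 4 (Reg 3))) (Load (Cell 4 (Bin Sub (Reg 3) (Load (Cell 1 (Reg 2))))))))
     Skip))
     (\<lambda>t s'. t \<le> (2 ^ n + 1) * 115 \<and> ?B i s' \<and> tuple_tab 0 (Suc i) (Suc i) s') s"
    if i: "i < n" and s: "?B i s" "tuple_tab 0 i i s" for i s
  proof (rule vc_For[where m = "2 ^ n" and T = 100 and
        I = "\<lambda>y s. ?B i s \<and> tuple_tab y (Suc i) i s \<and> regs s 3 = int y"], goal_cases)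
    case 1
    then show ?case by (simp add: small_exp_def)
  next
    case 2
    then show ?case by (rule exp2_less)
  next
    case 3
    then show ?case using s by (simp add: base_def nbr_tab_def zero5_def tuple_tab_def)
  next
    case (4 j s)
    then show ?case by (simp add: base_def)
  next
    case (5 y s)
    have p: "mem s (cell 1 (int i)) = 2 ^ i" using 5 i by (simp add: base_def)
    have tb: "exp_val (Test_bit (Reg 3) (Reg 2)) s = of_bool (bit y i)"
      using 5 p by (intro exp_val_Test_bit) auto
    show ?case
    proof (cases "bit y i")
      case True
      then have le: "2 ^ i \<le> y" by (rule bit_le)
      have ix: "int y - 2 ^ i = int (y - 2 ^ i)" using le by (simp add: of_nat_diff)
      have "y - 2 ^ i < y" using le zero_less_power[of "2 :: nat" i] by linarith
      then have v1: "mem s (cell 4 (int (y - 2 ^ i))) = int (tuple_count (Suc i) (y - 2 ^ i))"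
        using 5 by (simp add: tuple_tab_def)
      have v2: "mem s (cell 4 (int y)) = int (tuple_count i y)" using 5 by (simp add: tuple_tab_def)
      have v: "int (tuple_count i y) - int (tuple_count (Suc i) (y - 2 ^ i)) = int (tuple_count (Suc i) y)"
        using tuple_count_Suc[where i = i and y = y] True by (simp add: of_nat_diff)
      have "bnd b (int (tuple_count (Suc i) y))" using 5 by (intro bnd_int tuple_count_le) simp
      moreover have "exp_val (Bin Sub (Load (Cell 4 (Reg 3))) (Load (Cell 4 (Bin Sub (Reg 3) (Load (Cell 1 (Reg 2))))))) s =
          int (tuple_count (Suc i) y)"
        using 5 p v by (simp add: ix v1 v2)
      ultimately show ?thesis using 5 unfolding vc.simps
        by (auto simp: tb True base_def nbr_tab_def zero5_def tuple_tab_def less_Suc_eq simp del: exp_val.simps(4))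
    next
      case False
      then have "tuple_count (Suc i) y = tuple_count i y" by (simp add: tuple_count_Suc(1))
      then have "tuple_tab (Suc y) (Suc i) i s"
        using 5 by (auto simp: tuple_tab_def less_Suc_eq)
      then show ?thesis using 5
        by (simp add: tb False base_def nbr_tab_def zero5_def tuple_tab_def)
    qed
  next
    case (6 t s)
    then show ?case by (simp add: tuple_tab_def)
  qed
  show ?thesis
    unfolding moebius_prog_def
  proof (rule vc_For[where m = n and T = "(2 ^ n + 1) * 115" and I = "\<lambda>i s. ?B i s \<and> tuple_tab 0 i i s"], goal_cases)
    case 1
    then show ?case by (simp add: small_exp_def)
  next
    case 2
    then show ?case by (rule exp2_less)
  next
    case 3
    then show ?case using assms by (simp add: base_def nbr_tab_def zero5_def tuple_tab_def)
  next
    case (4 j s)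
    then show ?case by (simp add: base_def)
  next
    case (5 i s)
    then have s: "?B i s" "tuple_tab 0 i i s" and i: "i < n" by auto
    show ?case
      by (rule vc_mono[OF inner[OF i s]]) (auto simp: base_def nbr_tab_def zero5_def tuple_tab_def)
  next
    case (6 t s)
    then show ?case by simp
  qed
qed

section \<open>Elimination on masks\<close>

definition tcl_elim :: "(nat set \<times> nat set) set" where
  "tcl_elim = elim_step G (clique_coverable G k)"

definition reach :: "nat \<Rightarrow> bool" where
  "reach y \<longleftrightarrow> ({}, bits y) \<in> tcl_elim\<^sup>*"

definition next_mask :: "nat \<Rightarrow> nat \<Rightarrow> nat \<Rightarrow> bool" where
  "next_mask y v z \<longleftrightarrow> \<not> bit y v \<and> z = y + 2 ^ v \<and> clique_coverable G k (elim_bag G (bits y) v)"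

definition elim_tab :: "(nat \<Rightarrow> bool) \<Rightarrow> state \<Rightarrow> bool" where
  "elim_tab P s \<longleftrightarrow> (\<forall>z<2 ^ n. mem s (cell 5 (int z)) = of_bool (P z))"

lemma bits_step_iff:
  "(bits y, bits z) \<in> tcl_elim \<longleftrightarrow> (\<exists>v<n. next_mask y v z)"
proof
  assume "(bits y, bits z) \<in> tcl_elim"
  then obtain v where v: "v < n" "\<not> bit y v" "bits z = insert v (bits y)"
    "clique_coverable G k (elim_bag G (bits y) v)"
    by (auto simp: tcl_elim_def elim_step_def)
  then have "bits z = bits (y + 2 ^ v)" by (simp add: bits_add)
  then have "z = y + 2 ^ v" by (simp only: bits_inject)
  then show "\<exists>v<n. next_mask y v z" using v unfolding next_mask_def by blast
next
  assume "\<exists>v<n. next_mask y v z"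
  then obtain v where "v < n" "\<not> bit y v" "z = y + 2 ^ v" "clique_coverable G k (elim_bag G (bits y) v)"
    by (auto simp: next_mask_def)
  then show "(bits y, bits z) \<in> tcl_elim"
    unfolding tcl_elim_def elim_step_def
    by (auto simp: bits_add intro!: exI[of _ "bits y"] exI[of _ v])
qed

text \<open>Eliminating \<open>v\<close> adds \<open>2 ^ v\<close>, so every predecessor of
  \<open>z\<close> is a smaller number and lies below any \<open>m \<ge> z\<close>. The case
  \<open>m = z\<close> shows that a flag is final when its mask comes up, the case
  \<open>m = 2 ^ n\<close> that all flags are right at the end.\<close>

lemma reach_iff:
  assumes "z \<le> m"
  shows "(z = 0 \<or> (\<exists>y<m. reach y \<and> (\<exists>v<n. next_mask y v z))) \<longleftrightarrow> reach z"
proof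
  assume "z = 0 \<or> (\<exists>y<m. reach y \<and> (\<exists>v<n. next_mask y v z))"
  then show "reach z"
    unfolding reach_def bits_step_iff[symmetric] by (auto intro: rtrancl_into_rtrancl)
next
  assume r: "reach z"
  then have "bits z = {} \<or> (\<exists>S. ({}, S) \<in> tcl_elim\<^sup>* \<and> (S, bits z) \<in> tcl_elim)"
    unfolding reach_def by (metis rtranclE)
  then show "z = 0 \<or> (\<exists>y<m. reach y \<and> (\<exists>v<n. next_mask y v z))"
  proof
    assume "bits z = {}"
    then have "bits z = bits 0" by simp
    then have "z = 0" by (simp only: bits_inject)
    then show ?thesis by simp
  next
    assume "\<exists>S. ({}, S) \<in> tcl_elim\<^sup>* \<and> (S, bits z) \<in> tcl_elim"
    then obtain S where S: "({}, S) \<in> tcl_elim\<^sup>*" "(S, bits z) \<in> tcl_elim" by blast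
    then have "S \<subseteq> bits z" by (auto simp: tcl_elim_def elim_step_def)
    then have "finite S" by (rule finite_subset) simp
    then have y: "reach (code S)" "\<exists>v<n. next_mask (code S) v z"
      using S by (simp_all add: reach_def bits_code flip: bits_step_iff)
    from y(2) have "code S < z" by (auto simp: next_mask_def)
    then have "code S < m" using assms by simp
    then show ?thesis using y by blast
  qed
qed

text \<open>Stage \<open>i\<close> of Warshall's algorithm, with inner vertices restricted to the
  members of \<open>S\<close> below \<open>i\<close>. Members of \<open>S\<close> may belong to it,
  and so may \<open>u\<close> itself on a closed walk; \<open>steps_prog\<close> removes the former
  and adds \<open>u\<close> in any case.\<close>

definition wset :: "nat set \<Rightarrow> nat \<Rightarrow> nat \<Rightarrow> nat set" where
  "wset S i u = {v. v < n \<and> via E (S \<inter> {..<i}) u v}"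

lemma finite_wset [simp]: "finite (wset S i u)"
  by (rule finite_subset[of _ "{..<n}"]) (auto simp: wset_def)

lemma wset_0: "wset S 0 u = nbrs u"
  using nbrs_subset[of u] by (auto simp: wset_def via_empty nbrs_def)

lemma wset_Suc:
  assumes "i < n"
  shows "wset S (Suc i) u = (if i \<in> S \<and> i \<in> wset S i u then wset S i u \<union> wset S i i else wset S i u)"
proof (cases "i \<in> S")
  case True
  then have "S \<inter> {..<Suc i} = insert i (S \<inter> {..<i})" by (auto simp: less_Suc_eq)
  then show ?thesis using True assms by (auto simp: wset_def via_insert)
next
  case False
  then have "S \<inter> {..<Suc i} = S \<inter> {..<i}" by (auto simp: less_Suc_eq)
  then show ?thesis using False by (simp add: wset_def)
qed

definition warshall_tab :: "nat set \<Rightarrow> nat \<Rightarrow> nat \<Rightarrow> nat \<Rightarrow> state \<Rightarrow> bool" where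
  "warshall_tab S m i i' s \<longleftrightarrow>
     (\<forall>u<n. mem s (cell 6 (int u)) = int (code (wset S (if u < m then i else i') u)))"

lemma bnd_code: "A \<subseteq> {..<n} \<Longrightarrow> bnd b (int (code A))"
proof (rule bnd_int)
  assume "A \<subseteq> {..<n}"
  then have "code A < 2 ^ n" by (rule code_less)
  also have "\<dots> \<le> 2 ^ (n * n + n + 2)" by (intro power_increasing) auto
  finally show "code A \<le> 2 ^ (n * n + n + 2)" by simp
qed

lemma wset_subset: "wset S i u \<subseteq> {..<n}"
  by (auto simp: wset_def)

abbreviation elim_inv :: "nat \<Rightarrow> (nat \<Rightarrow> bool) \<Rightarrow> state \<Rightarrow> bool" where
  "elim_inv y P s \<equiv> base s \<and> nbr_tab s \<and> tuple_tab 0 n n s \<and> elim_tab P s \<and> regs s 3 = int y"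

lemma warshall_correct:
  assumes "elim_inv y P s"
  shows "vc warshall_prog (\<lambda>t s'. t \<le> (n + 1) * 110 + (n + 1) * (140 * (n + 1) + 10) \<and>
    elim_inv y P s' \<and> warshall_tab (bits y) 0 n n s') s"
proof -
  let ?S = "bits y"
  note defs = base_def nbr_tab_def tuple_tab_def elim_tab_def warshall_tab_def
  have init: "vc (For 5 (Reg 0) (Store (Cell 6 (Reg 5)) (Load (Cell 2 (Reg 5)))))
    (\<lambda>t s'. t \<le> (n + 1) * 110 \<and> elim_inv y P s' \<and> warshall_tab ?S 0 0 0 s') s"
  proof (rule vc_For[where m = n and T = 100 and
        I = "\<lambda>u s. elim_inv y P s \<and> (\<forall>v<u. mem s (cell 6 (int v)) = int (code (nbrs v))) \<and> regs s 5 = int u"], goal_cases)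
    case 1
    then show ?case by (simp add: small_exp_def)
  next
    case 2
    then show ?case by (rule exp2_less)
  next
    case 3
    then show ?case using assms by (simp add: defs)
  next
    case (4 j s)
    then show ?case by (simp add: base_def)
  next
    case (5 u s)
    have "mem s (cell 2 (int u)) = int (code (nbrs u))" using 5 by (simp add: nbr_tab_def)
    then show ?case using 5 bnd_code[OF nbrs_subset, of u] by (auto simp: defs less_Suc_eq)
  next
    case (6 t s)
    then show ?case by (simp add: warshall_tab_def wset_0)
  qed
  have inner: "vc (For 5 (Reg 0) (If (Test_bit (Load (Cell 6 (Reg 5))) (Reg 6))
         (Store (Cell 6 (Reg 5)) (Bin Or (Load (Cell 6 (Reg 5))) (Load (Cell 6 (Reg 6)))))
         Skip))
    (\<lambda>t s'. t \<le> (n + 1) * 110 \<and> elim_inv y P s' \<and> warshall_tab ?S 0 (Suc i) (Suc i) s' \<and> regs s' 6 = int i) s"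
    if i: "i < n" "bit y i" and s: "elim_inv y P s" "warshall_tab ?S 0 i i s" "regs s 6 = int i" for i s
  proof (rule vc_For[where m = n and T = 100 and
        I = "\<lambda>u s. elim_inv y P s \<and> warshall_tab ?S u (Suc i) i s \<and> regs s 6 = int i \<and> regs s 5 = int u"], goal_cases)
    case 1
    then show ?case by (simp add: small_exp_def)
  next
    case 2
    then show ?case by (rule exp2_less)
  next
    case 3
    then show ?case using s by (simp add: defs)
  next
    case (4 j s)
    then show ?case by (simp add: base_def)
  next
    case (5 u s)
    have r: "regs s 5 = int u" "regs s 6 = int i" and p: "mem s (cell 1 (int i)) = 2 ^ i"
      using 5 i by (auto simp: base_def)
    have mu: "mem s (cell 6 (int u)) = int (code (wset ?S i u))" using 5 by (simp add: warshall_tab_def)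
    \<comment> \<open>Updating in place is harmless: phase \<open>i\<close> could only join row
      \<open>i\<close> with itself, so it holds the same set whether or not it has been
      processed.\<close>
    have mi: "mem s (cell 6 (int i)) = int (code (wset ?S i i))"
      using 5 i wset_Suc[OF i(1), of ?S i] by (auto simp: warshall_tab_def)
    have tb: "exp_val (Test_bit (Load (Cell 6 (Reg 5))) (Reg 6)) s = of_bool (i \<in> wset ?S i u)"
    proof -
      have "exp_val (Test_bit (Load (Cell 6 (Reg 5))) (Reg 6)) s = of_bool (bit (code (wset ?S i u)) i)"
        by (rule exp_val_Test_bit) (simp_all add: r p mu)
      also have "bit (code (wset ?S i u)) i \<longleftrightarrow> i \<in> wset ?S i u"
        using bits_code[OF finite_wset] by (metis mem_bits)
      finally show ?thesis .
    qed
    show ?case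
    proof (cases "i \<in> wset ?S i u")
      case True
      then have "or (int (code (wset ?S i u))) (int (code (wset ?S i i))) = int (code (wset ?S (Suc i) u))"
        using i by (simp add: wset_Suc[OF i(1)] code_or flip: of_nat_or_eq)
      then show ?thesis using 5 bnd_code[OF wset_subset, of ?S "Suc i" u]
        by (auto simp: tb True r mu mi defs less_Suc_eq)
    next
      case False
      then have "wset ?S (Suc i) u = wset ?S i u" by (simp add: wset_Suc[OF i(1)])
      then have "warshall_tab ?S (Suc u) (Suc i) i s" using 5 by (auto simp: warshall_tab_def less_Suc_eq)
      then show ?thesis using 5 by (simp add: tb False defs)
    qed
  next
    case (6 t s)
    then show ?case by (simp add: warshall_tab_def)
  qed
  have loop: "vc (For 6 (Reg 0) (If (Test_bit (Reg 3) (Reg 6))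
       (For 5 (Reg 0) (If (Test_bit (Load (Cell 6 (Reg 5))) (Reg 6))
         (Store (Cell 6 (Reg 5)) (Bin Or (Load (Cell 6 (Reg 5))) (Load (Cell 6 (Reg 6)))))
         Skip))
       Skip))
    (\<lambda>t s'. t \<le> (n + 1) * (140 * (n + 1) + 10) \<and> elim_inv y P s' \<and> warshall_tab ?S 0 n n s') s"
    if s: "elim_inv y P s" "warshall_tab ?S 0 0 0 s" for s
  proof (rule vc_For[where m = n and T = "140 * (n + 1)" and
        I = "\<lambda>i s. elim_inv y P s \<and> warshall_tab ?S 0 i i s \<and> regs s 6 = int i"], goal_cases)
    case 1
    then show ?case by (simp add: small_exp_def)
  next
    case 2
    then show ?case by (rule exp2_less)
  next
    case 3
    then show ?case using s by (simp add: defs)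
  next
    case (4 j s)
    then show ?case by (simp add: base_def)
  next
    case (5 i s)
    then have s: "elim_inv y P s" "warshall_tab ?S 0 i i s" "regs s 6 = int i" and i: "i < n" by auto
    have p: "mem s (cell 1 (int i)) = 2 ^ i" using 5 by (simp add: base_def)
    have tb: "exp_val (Test_bit (Reg 3) (Reg 6)) s = of_bool (bit y i)"
      by (rule exp_val_Test_bit) (simp_all add: s p)
    show ?case
    proof (cases "bit y i")
      case True
      show ?thesis
        unfolding vc.simps tb
        using True by (intro conjI impI vc_mono[OF inner[OF i True s]]) (auto simp: defs)
    next
      case False
      then have "wset ?S (Suc i) u = wset ?S i u" for u by (simp add: wset_Suc[OF i])
      then show ?thesis using s False by (simp add: tb defs)
    qed
  next
    case (6 t s)
    then show ?case by simp
  qed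
  show ?thesis
    unfolding warshall_prog_def vc.simps
    by (rule vc_mono[OF init], rule vc_mono[OF loop]) auto
qed

lemma tuple_count_code:
  assumes "A \<subseteq> {..<n}"
  shows "tuple_count n (code A) \<noteq> 0 \<longleftrightarrow> clique_coverable G k A"
proof -
  have f: "finite A" using assms finite_subset by blast
  moreover have "A \<inter> {..<n} = A" using assms by blast
  ultimately show ?thesis by (simp add: tuple_count_def bits_code clique_coverable_iff_card)
qed

lemma steps_correct:
  assumes y: "y < 2 ^ n" and s: "elim_inv y P s" "warshall_tab (bits y) 0 n n s"
  shows "vc steps_prog (\<lambda>t s'. t \<le> (n + 1) * 110 \<and>
    elim_inv y (\<lambda>z. P z \<or> (\<exists>v<n. next_mask y v z)) s') s"
proof -
  note defs = base_def nbr_tab_def tuple_tab_def elim_tab_def warshall_tab_def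
  have yn: "bits y \<subseteq> {..<n}" using y by (simp add: bits_subset_iff)
  show ?thesis
    unfolding steps_prog_def
  proof (rule vc_For[where m = n and T = 100 and
        I = "\<lambda>u s. elim_inv y (\<lambda>z. P z \<or> (\<exists>v<u. next_mask y v z)) s \<and>
          warshall_tab (bits y) 0 n n s \<and> regs s 5 = int u"], goal_cases)
    case 1
    then show ?case by (simp add: small_exp_def)
  next
    case 2
    then show ?case by (rule exp2_less)
  next
    case 3
    then show ?case using s by (simp add: defs)
  next
    case (4 j s)
    then show ?case by (simp add: base_def)
  next
    case (5 v s)
    have r: "regs s 5 = int v" "regs s 3 = int y" and p: "mem s (cell 1 (int v)) = 2 ^ v"
      using 5 by (auto simp: base_def)
    have tb: "exp_val (Test_bit (Reg 3) (Reg 5)) s = of_bool (bit y v)"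
      by (rule exp_val_Test_bit) (simp_all add: r p)
    let ?B = "elim_bag G (bits y) v"
    have Bn: "?B \<subseteq> {..<n}" using 5 by (auto simp: elim_bag_def)
    have mv: "mem s (cell 6 (int v)) = int (code (wset (bits y) n v))" using 5 by (simp add: warshall_tab_def)
    have "or (xor (int (code (wset (bits y) n v))) (and (int (code (wset (bits y) n v))) (int y))) (2 ^ v) =
      int (or (xor (code (wset (bits y) n v)) (and (code (wset (bits y) n v)) (code (bits y)))) (code {v}))"
      by (simp add: of_nat_or_eq of_nat_and_eq of_nat_xor_eq flip: code_singleton)
    also have "\<dots> = int (code (wset (bits y) n v - bits y \<union> {v}))"
      by (simp only: code_diff code_or finite_wset finite_bits finite_Diff finite.emptyI finite.insertI)
    \<comment> \<open>All of \<open>bits y\<close> lies below \<open>n\<close>, so stage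
      \<open>n\<close> no longer restricts the inner vertices.\<close>
    also have "wset (bits y) n v - bits y \<union> {v} = ?B"
      using 5 unfolding wset_def elim_bag_def Int_absorb2[OF yn] by auto
    finally have bag: "or (xor (int (code (wset (bits y) n v))) (and (int (code (wset (bits y) n v))) (int y))) (2 ^ v) =
      int (code ?B)" .
    have mB: "mem s (cell 4 (int (code ?B))) = int (tuple_count n (code ?B))"
      using 5 code_less[OF Bn] by (simp add: tuple_tab_def)
    have cov: "tuple_count n (code ?B) = 0 \<longleftrightarrow> \<not> clique_coverable G k ?B"
      using tuple_count_code[OF Bn] by blast
    have bnd1: "bnd b 1" using bnd_exp2[of 0] by simp
    have bndB: "bnd b (int (code ?B))" using Bn by (rule bnd_code)
    have ix: "int y + 2 ^ v = int (y + 2 ^ v)" by simp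
    show ?case
    proof (cases "next_mask y v (y + 2 ^ v)")
      case True
      then have b: "\<not> bit y v" and c: "clique_coverable G k ?B" by (auto simp: next_mask_def)
      have nm: "next_mask y v z \<longleftrightarrow> z = y + 2 ^ v" for z using True by (auto simp: next_mask_def)
      show ?thesis unfolding vc.simps tb using 5
        by (auto simp: b r p mv bag bndB mB cov c bnd1 ix defs less_Suc_eq nm ex_disj_distrib conj_disj_distribR
            simp del: of_nat_add of_nat_power)
    next
      case False
      then have nm: "\<not> next_mask y v z" for z by (auto simp: next_mask_def)
      have e: "(\<exists>u<Suc v. next_mask y u z) \<longleftrightarrow> (\<exists>u<v. next_mask y u z)" for z
        using nm by (auto simp: less_Suc_eq)
      show ?thesis
      proof (cases "bit y v")
        case True
        then show ?thesis using 5 by (simp add: tb e defs)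
      next
        case b: False
        then have "\<not> clique_coverable G k ?B" using False by (simp add: next_mask_def)
        then show ?thesis unfolding vc.simps tb using 5
          by (simp add: b r p mv bag bndB mB cov e defs)
      qed
    qed
  next
    case (6 t s)
    then show ?case by simp
  qed
qed

lemma elim_correct:
  assumes "base s" "nbr_tab s" "tuple_tab 0 n n s" "zero5 s"
  shows "vc elim_prog (\<lambda>t s'. t \<le> (2 ^ n + 1) * (elim_time n + 15) + 20 \<and> base s' \<and> elim_tab reach s') s"
proof -
  note defs = base_def nbr_tab_def tuple_tab_def elim_tab_def
  \<comment> \<open>The flags set once the masks below \<open>m\<close> have been expanded;
    \<open>z = 0\<close> is the empty mask marked at the start.\<close>
  let ?P = "\<lambda>m z. z = 0 \<or> (\<exists>y<m. reach y \<and> (\<exists>v<n. next_mask y v z))"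
  show ?thesis
    unfolding elim_prog_def vc.simps
  proof (intro conjI, goal_cases)
    case 1
    then show ?case using bnd_exp2[of 0] by simp
  next
    case 2
    show ?case
    proof (rule vc_For[where m = "2 ^ n" and T = "elim_time n" and I = "\<lambda>y s. elim_inv y (?P y) s"], goal_cases)
      case 1
      then show ?case
        by (simp add: small_exp_def warshall_prog_def steps_prog_def)
    next
      case 2
      then show ?case by (rule exp2_less)
    next
      case 3
      then show ?case using assms by (auto simp: defs zero5_def)
    next
      case (4 j s)
      then show ?case by (simp add: base_def)
    next
      case (5 y s)
      then have s: "elim_inv y (?P y) s" and y: "y < 2 ^ n" by auto
      have "mem s (cell 5 (int y)) = of_bool (?P y y)"
        using s y unfolding elim_tab_def by blast
      then have m: "mem s (cell 5 (int y)) = of_bool (reach y)" unfolding reach_iff[OF order.refl] .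
      have r: "regs s 3 = int y" using s by simp
      show ?case
      proof (cases "reach y")
        case True
        have "(\<exists>x<Suc y. reach x \<and> (\<exists>v<n. next_mask x v z)) \<longleftrightarrow>
          (\<exists>x<y. reach x \<and> (\<exists>v<n. next_mask x v z)) \<or> (\<exists>v<n. next_mask y v z)" for z
          using True less_Suc_eq by auto
        then have e: "?P (Suc y) z \<longleftrightarrow> ?P y z \<or> (\<exists>v<n. next_mask y v z)" for z
          by blast
        have "vc (Seq warshall_prog steps_prog) (\<lambda>t s'. t + 10 \<le> elim_time n \<and> elim_inv y (?P (Suc y)) s') s"
          unfolding vc.simps
          by (rule vc_mono[OF warshall_correct[OF s]], rule vc_mono[OF steps_correct[OF y]])
            (auto simp: elim_time_def e)
        then have "vc (Seq warshall_prog steps_prog) (\<lambda>t s'. exp_cost (Load (Cell 5 (Reg 3))) + 1 + t \<le> elim_time n \<and>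
            regs s' 3 = int y \<and> elim_inv (Suc y) (?P (Suc y)) (s'\<lparr>regs := (regs s')(3 := int (Suc y))\<rparr>)) s"
          by (rule vc_mono) (auto simp: defs)
        then show ?thesis using True m r by (simp only: vc.simps(5)) (simp add: True)
      next
        case False
        have e: "?P (Suc y) z \<longleftrightarrow> ?P y z" for z
          using False less_Suc_eq by auto
        have "elim_tab (?P (Suc y)) s" using s unfolding e by blast
        then show ?thesis using s False m r by (simp add: defs elim_time_def)
      qed
    next
      case (6 t s)
      have "mem s (cell 5 (int z)) = of_bool (reach z)" if "z < 2 ^ n" for z
      proof -
        have "mem s (cell 5 (int z)) = of_bool (?P (2 ^ n) z)"
          using 6 that unfolding elim_tab_def by blast
        then show ?thesis using reach_iff[of z "2 ^ n"] that by simp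
      qed
      then have "elim_tab reach s" by (simp add: elim_tab_def)
      moreover have "base s" using 6(1) by blast
      ultimately show ?case using 6(2) by (simp add: algebra_simps)
    qed
  qed
qed

section \<open>The complete program and its running time\<close>

lemma ok_input: "ok b (input_state n E (int k))"
proof -
  have le: "i \<le> 2 ^ (n * n + n + 2)" if "i \<le> n" for i :: nat
    using less_exp[of "n * n + n + 2"] that by linarith
  have "bnd b (int n)" "bnd b (int k)" using kn by (intro bnd_int le; simp)+
  moreover have "bnd b 0" "bnd b 1" using bnd_int[of 0] bnd_int[of 1] by simp_all
  ultimately show ?thesis by (simp add: ok_def input_state_def)
qed

lemma zero5_input: "zero5 (input_state n E (int k))"
proof -
  have "mem (input_state n E (int k)) (cell 5 (int y)) = 0" for y
  proof -
    have "cell 5 (int y) \<noteq> int (i * n + j)" for i j by (rule cell_neq_nonneg) simp_all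
    then show ?thesis by (simp add: input_state_def)
  qed
  then show ?thesis by (simp add: zero5_def)
qed

lemma reach_full: "reach (2 ^ n - 1) \<longleftrightarrow> tcl G \<le> k"
  by (simp add: reach_def bits_mask[of n, simplified] tcl_elim_def tcl_le_iff_elim[OF sg])

lemma main_correct:
  "vc main_prog (\<lambda>t s'. t \<le> main_time n \<and> regs s' 0 = of_bool (tcl G \<le> k)) (input_state n E (int k))"
proof -
  let ?e = "Load (Cell 5 (Bin Sub (Load (Cell 1 (Reg 0))) (Const 1)))"
  have fin: "vc (Assign 0 ?e) (\<lambda>t s'. t \<le> 40 \<and> regs s' 0 = of_bool (tcl G \<le> k)) s"
    if s: "base s" "elim_tab reach s" for s
  proof -
    have "(2 :: nat) ^ n - 1 < 2 ^ n" by simp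
    then have "mem s (cell 5 (int (2 ^ n - 1))) = of_bool (tcl G \<le> k)"
      using s(2) unfolding elim_tab_def reach_full[symmetric] by blast
    moreover have "int (2 ^ n - 1) = 2 ^ n - 1" by (simp add: of_nat_diff)
    ultimately have "exp_val ?e s = of_bool (tcl G \<le> k)" using s(1) by (simp add: base_def)
    moreover have "bnd b (of_bool c)" for c
      using bnd_int[of 0] bnd_int[of 1] by (cases c) simp_all
    ultimately show ?thesis unfolding vc.simps by simp
  qed
  have "regs (input_state n E (int k)) 0 = int n" "regs (input_state n E (int k)) 1 = int k"
    by (simp_all add: input_state_def)
  moreover have "input_mem (input_state n E (int k))" by (simp add: input_mem_def)
  ultimately show ?thesis
    unfolding main_prog_def vc.simps(4)
    apply -
    apply (rule vc_mono[OF powers_correct], assumption, assumption, assumption, rule zero5_input)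
    apply (rule vc_mono[OF nbrs_correct], blast, blast, blast)
    apply (rule vc_mono[OF cliques_correct], blast, blast, blast)
    apply (rule vc_mono[OF tuples_correct], blast, blast, blast, blast)
    apply (rule vc_mono[OF moebius_correct], blast, blast, blast, blast)
    apply (rule vc_mono[OF elim_correct], blast, blast, blast, blast)
    apply (rule vc_mono[OF fin], blast, blast)
    apply (simp add: main_time_def)
    done
qed

end

text \<open>The parameter is capped at \<open>n\<close> since it may be as large as a word permits.\<close>

definition tcl_prog :: com where
  "tcl_prog = If (Bin Lt (Reg 1) (Const 0)) (Assign 0 (Const 0))
     (Seq (If (Bin Lt (Reg 0) (Reg 1)) (Assign 1 (Reg 0)) Skip) main_prog)"

text \<open>The witnesses 200 and 2 are chosen so that \<open>40 * b + 1 \<le> w\<close> holds for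
  \<open>b = n * n + n + 4\<close>. A negative parameter is answered at once, since
  \<open>tcl\<close> is a natural number.\<close>

lemma tcl_prog_decides:
  "decides_in_time tcl_prog (\<lambda>G k. int (tcl G) \<le> k) (\<lambda>n. real (main_time n + 50))"
  unfolding decides_in_time_def
proof (rule exI[of _ 200], rule exI[of _ 2], intro allI impI)
  fix n E and k :: int and w
  assume sg: "simple_graph ({..<n}, E)" and w: "200 * (n + 1) ^ 2 \<le> w" and k: "fits w k"
  let ?G = "({..<n}, E)" and ?s = "input_state n E k"
  have w': "40 * (n * n + n + 4) + 1 \<le> w" using w by (simp add: power2_eq_square)
  have "2 * int n < 2 ^ w"
  proof -
    have "int n < 2 ^ n" by simp
    then have "2 * int n < 2 ^ Suc n" by simp
    also have "\<dots> \<le> (2 :: int) ^ w" using w' by (intro power_increasing) auto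
    finally show ?thesis .
  qed
  then have fn: "fits w (int n)" by (simp add: fits_def order.trans[of _ 0])
  have "(2 :: int) ^ 2 \<le> 2 ^ w" using w' by (intro power_increasing) auto
  then have f01: "fits w 0" "fits w 1" by (auto simp: fits_def)
  then have fb: "fits w (of_bool c)" for c by (cases c) auto
  have regs: "regs ?s 0 = int n" "regs ?s 1 = k" by (auto simp: input_state_def)
  have neg: "exp_fits w (Bin Lt (Reg 1) (Const 0)) ?s" using f01 fb k regs by simp
  show "\<exists>t s'. exec w tcl_prog ?s t s' \<and> real t \<le> real (main_time n + 50) \<and>
    regs s' 0 = of_bool (int (tcl ?G) \<le> k)"
  proof (cases "k < 0")
    case True
    have "exec w (Assign 0 (Const 0)) ?s (exp_cost (Const 0) + 1) (?s\<lparr>regs := (regs ?s)(0 := exp_val (Const 0) ?s)\<rparr>)"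
      by (rule exec.Assign) (simp add: f01)
    moreover have "exp_val (Bin Lt (Reg 1) (Const 0)) ?s \<noteq> 0" using True regs by simp
    ultimately have "exec w tcl_prog ?s (exp_cost (Bin Lt (Reg 1) (Const 0)) + 1 + (exp_cost (Const 0) + 1))
      (?s\<lparr>regs := (regs ?s)(0 := exp_val (Const 0) ?s)\<rparr>)"
      unfolding tcl_prog_def by (intro exec.IfTrue[OF neg])
    moreover have "real (exp_cost (Bin Lt (Reg 1) (Const 0)) + 1 + (exp_cost (Const 0) + 1)) \<le> real (main_time n + 50)"
      by simp
    moreover have "regs (?s\<lparr>regs := (regs ?s)(0 := exp_val (Const 0) ?s)\<rparr>) 0 = of_bool (int (tcl ?G) \<le> k)"
      using True by simp
    ultimately show ?thesis by blast
  next
    case False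
    define k' where "k' = nat (min k (int n))"
    have k': "int k' = min k (int n)" using False by (simp add: k'_def)
    interpret tcl_program w "n * n + n + 4" n k' E
      by unfold_locales (use w' sg in \<open>auto simp: k'_def\<close>)
    let ?clip = "If (Bin Lt (Reg 0) (Reg 1)) (Assign 1 (Reg 0)) Skip"
    have clip: "\<exists>t. exec w ?clip ?s t (input_state n E (int k')) \<and> t \<le> 10"
    proof (cases "int n < k")
      case True
      have "exec w (Assign 1 (Reg 0)) ?s (exp_cost (Reg 0) + 1) (?s\<lparr>regs := (regs ?s)(1 := exp_val (Reg 0) ?s)\<rparr>)"
        by (rule exec.Assign) (simp add: fn regs)
      moreover have "?s\<lparr>regs := (regs ?s)(1 := exp_val (Reg 0) ?s)\<rparr> = input_state n E (int k')"
        using True k' by (simp add: input_state_def)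
      ultimately have "exec w ?clip ?s (exp_cost (Bin Lt (Reg 0) (Reg 1)) + 1 + (exp_cost (Reg 0) + 1)) (input_state n E (int k'))"
        by (intro exec.IfTrue) (use True fn fb f01 k regs in simp_all)
      then show ?thesis by (intro exI conjI) (assumption, simp)
    next
      case F: False
      then have "int k' = k" using k' by simp
      then have "exec w ?clip ?s (exp_cost (Bin Lt (Reg 0) (Reg 1)) + 1 + 1) (input_state n E (int k'))"
        by (intro exec.IfFalse) (use F fn fb f01 k regs in \<open>simp_all add: exec.Skip[simplified]\<close>)
      then show ?thesis by (intro exI conjI) (assumption, simp)
    qed
    then obtain t1 where 1: "exec w ?clip ?s t1 (input_state n E (int k'))" "t1 \<le> 10" by blast
    from vc_sound[OF ok_input small_com_main main_correct] obtain t2 s' where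
      2: "exec w main_prog (input_state n E (int k')) t2 s'" "t2 \<le> main_time n"
        "regs s' 0 = of_bool (tcl ?G \<le> k')" by blast
    have "exec w tcl_prog ?s (exp_cost (Bin Lt (Reg 1) (Const 0)) + 1 + (t1 + t2)) s'"
      unfolding tcl_prog_def
      by (rule exec.IfFalse[OF neg _ exec.Seq[OF 1(1) 2(1)]]) (use False regs in simp)
    moreover have "int (tcl ?G) \<le> int n" using tcl_le_card[OF sg] by simp
    then have "int (tcl ?G) \<le> int k' \<longleftrightarrow> int (tcl ?G) \<le> k" unfolding k' by linarith
    then have "regs s' 0 = of_bool (int (tcl ?G) \<le> k)" using 2(3) by (simp only: of_nat_le_iff)
    moreover have "real (exp_cost (Bin Lt (Reg 1) (Const 0)) + 1 + (t1 + t2)) \<le> real (main_time n + 50)"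
      using 1(2) 2(2) by simp
    ultimately show ?thesis by blast
  qed
qed

lemma main_time_le: "main_time n + 50 \<le> 3000 * (n + 1) ^ 2 * 2 ^ n"
proof -
  define m where "m = n + 1"
  define q where "q = (2 :: nat) ^ n"
  have q: "1 \<le> q" and m: "1 \<le> m" by (auto simp: q_def m_def)
  have n: "n + 2 = m + 1" "n + 1 = m" by (simp_all add: m_def)
  \<comment> \<open>Every monomial is at most \<open>m ^ 2 * q\<close>, and the coefficients sum to
    2094.\<close>
  have "main_time n + 50 =
      270 * m\<^sup>2 + 140 * (m\<^sup>2 * q) + 732 * m + 590 * (m * q) + 50 * q + 312"
    unfolding main_time_def elim_time_def q_def[symmetric] n
    by (simp add: algebra_simps power2_eq_square)
  moreover have "m\<^sup>2 \<le> m\<^sup>2 * q" "q \<le> m\<^sup>2 * q" "m * q \<le> m\<^sup>2 * q"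
    using q m by (simp_all add: power2_eq_square)
  moreover from this have "m \<le> m\<^sup>2 * q" "1 \<le> m\<^sup>2 * q"
    using q m by (simp_all add: power2_eq_square)
  ultimately have "main_time n + 50 \<le> 3000 * (m\<^sup>2 * q)" by linarith
  then show ?thesis by (simp add: m_def q_def)
qed

theorem theorem5:
  shows "\<exists>(P :: com) (f :: nat \<Rightarrow> real) (d :: nat).
           f \<in> O(\<lambda>n. real n ^ d * 2.4423 ^ n) \<and>
           decides_in_time P (\<lambda>G k. int (tcl G) \<le> k) f"
proof (intro exI conjI)
  show "decides_in_time tcl_prog (\<lambda>G k. int (tcl G) \<le> k) (\<lambda>n. real (main_time n + 50))"
    by (rule tcl_prog_decides)
  show "(\<lambda>n. real (main_time n + 50)) \<in> O(\<lambda>n. real n ^ 2 * 2.4423 ^ n)"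
  \<comment> \<open>\<open>n + 1 \<le> 2 * n\<close> turns the constant 3000 into
    \<open>3000 * 4\<close>. At \<open>n = 0\<close> the polynomial factor vanishes, so the estimate
    starts at 1.\<close>
  proof (rule bigoI[of _ 12000], rule eventually_mono[OF eventually_ge_at_top[of 1]])
    fix n :: nat assume n: "1 \<le> n"
    have "real (main_time n + 50) \<le> real (3000 * (n + 1) ^ 2 * 2 ^ n)"
      using main_time_le[of n] by (simp only: of_nat_le_iff)
    also have "\<dots> = 3000 * (real n + 1) ^ 2 * 2 ^ n" by simp
    also have "\<dots> \<le> 3000 * (2 * real n) ^ 2 * 2.4423 ^ n"
      using n by (intro mult_mono power_mono) auto
    also have "\<dots> = 12000 * (real n ^ 2 * 2.4423 ^ n)" by (simp add: power_mult_distrib)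
    finally show "norm (real (main_time n + 50)) \<le> 12000 * norm (real n ^ 2 * 2.4423 ^ n)" by simp
  qed
qed

end
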